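(* Let $\Omega\subset\mathbb{RP}^3$ be a properly convex, divisible, indecomposable domain with its Hilbert metric $d_\Omega$ and with dividing group $\Gamma$, and let $\delta_\Gamma$ be the critical exponent of $\Gamma$. Then $\Gamma$ is of divergent type, i.e. for $x,y\in\Omega$ the series $$\sum_{\gamma\in\Gamma}e^{-\delta_\Gamma d_\Omega(x,\gamma y)}$$ diverges.
   Context: A domain $\Omega\subset\mathbb{RP}^n$ is properly convex if it is a bounded convex set in some affine chart; fix such a chart. It is indecomposable if the cone over $\Omega$ in $\mathbb R^{n+1}$ is not a direct sum of lower-dimensional convex cones in complementary subspaces. The Hilbert metric is $d_\Omega(x,x)=0$ and, for $x\ne y$ in $\Omega$, $d_\Omega(x,y)=\frac12|\log[a:x:y:b]|$, where $a,b$ are the two intersection points of the projective line $\overline{xy}$ with $\partial\Omega$ and $[a:x:y:b]=\frac{|a-y||x-b|}{|a-x||y-b|}$. $\operatorname{Aut}(\Omega)=\{g\in\mathrm{PSL}(n+1,\mathbb R):g\Omega=\Omega\}$ acts by isometries. $\Omega$ is divisible with dividing group $\Gamma$ if $\Gamma$ is a discrete subgroup of $\operatorname{Aut}(\Omega)$ acting properly discontinuously and cocompactly on $\Omega$. The critical exponent $\delta_\Gamma$ is the critical value of $s\ge0$ for the Poincaré series $P(x,y,s)=\sum_{\gamma\in\Gamma}e^{-sd_\Omega(x,\gamma y)}$ (convergence for $s>\delta_\Gamma$, divergence for $s<\delta_\Gamma$); convergence of the series does not depend on $x,y$. *)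

theory Defs
  imports "HOL-Analysis.Analysis" "HOL-Algebra.Coset"
begin

subsection \<open>Quotient topologies\<close>

definition quotient_topology :: "'a topology \<Rightarrow> ('a \<Rightarrow> 'b) \<Rightarrow> 'b topology" where
  "quotient_topology X f =
     topology (\<lambda>U. U \<subseteq> f ` topspace X \<and> openin X {x \<in> topspace X. f x \<in> U})"

lemma openin_quotient_topology:
  "openin (quotient_topology X f) U \<longleftrightarrow>
     U \<subseteq> f ` topspace X \<and> openin X {x \<in> topspace X. f x \<in> U}"
proof -
  have "istopology (\<lambda>U. U \<subseteq> f ` topspace X \<and> openin X {x \<in> topspace X. f x \<in> U})"
    unfolding istopology_def
  proof (intro conjI allI impI)
    fix S T
    assume S: "S \<subseteq> f ` topspace X \<and> openin X {x \<in> topspace X. f x \<in> S}"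
      and T: "T \<subseteq> f ` topspace X \<and> openin X {x \<in> topspace X. f x \<in> T}"
    show "S \<inter> T \<subseteq> f ` topspace X" using S by blast
    have "{x \<in> topspace X. f x \<in> S \<inter> T}
        = {x \<in> topspace X. f x \<in> S} \<inter> {x \<in> topspace X. f x \<in> T}" by blast
    then show "openin X {x \<in> topspace X. f x \<in> S \<inter> T}" using S T by auto
  next
    fix \<K>
    assume K: "\<forall>K\<in>\<K>. K \<subseteq> f ` topspace X \<and> openin X {x \<in> topspace X. f x \<in> K}"
    show "\<Union>\<K> \<subseteq> f ` topspace X" using K by blast
    have "{x \<in> topspace X. f x \<in> \<Union>\<K>} = (\<Union>K\<in>\<K>. {x \<in> topspace X. f x \<in> K})" by blast
    then show "openin X {x \<in> topspace X. f x \<in> \<Union>\<K>}" using K by auto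
  qed
  then show ?thesis by (simp add: quotient_topology_def topology_inverse')
qed

lemma topspace_quotient_topology: "topspace (quotient_topology X f) = f ` topspace X"
proof -
  have "{x \<in> topspace X. f x \<in> f ` topspace X} = topspace X" by blast
  then have "openin (quotient_topology X f) (f ` topspace X)"
    by (simp add: openin_quotient_topology)
  then show ?thesis
    by (metis openin_quotient_topology openin_subset openin_topspace subset_antisym)
qed

lemma quotient_map_quotient_topology: "quotient_map X (quotient_topology X f) f"
  by (auto simp: quotient_map_def topspace_quotient_topology openin_quotient_topology)


subsection \<open>Projective space and affine charts\<close>

text \<open>A point of the projectivisation of \<^typ>\<open>real^'n\<close> is a line through the origin, so that
  \<open>\<real>P\<^sup>n\<close> corresponds to \<open>CARD('n) = n + 1\<close>.\<close>

definition projective_topology :: "(real^'n) set topology" where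
  "projective_topology = quotient_topology (top_of_set (- {0})) (\<lambda>v. span {v})"

definition projective_space :: "(real^'n) set set" where
  "projective_space = (\<lambda>v. span {v}) ` (- {0})"

lemma topspace_projective_topology: "topspace projective_topology = projective_space"
  by (simp add: projective_topology_def projective_space_def topspace_quotient_topology)

definition projective_domain :: "(real^'n) set set \<Rightarrow> bool" where
  "projective_domain \<Omega> \<longleftrightarrow>
     \<Omega> \<noteq> {} \<and> openin projective_topology \<Omega> \<and> connectedin projective_topology \<Omega>"

text \<open>The nonzero vector \<open>c\<close> determines the affine chart obtained by removing the projective
  hyperplane \<open>c\<^sup>\<bottom>\<close>; a point of it is represented by its intersection with the affine
  hyperplane \<open>{v. c \<bullet> v = 1}\<close>, which carries the Euclidean metric of \<^typ>\<open>real^'n\<close>.\<close>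

definition affine_chart :: "real^'n \<Rightarrow> (real^'n) set set" where
  "affine_chart c = {l \<in> projective_space. \<exists>v\<in>l. c \<bullet> v \<noteq> 0}"

definition chart_coord :: "real^'n \<Rightarrow> (real^'n) set \<Rightarrow> real^'n" where
  "chart_coord c l = (THE v. v \<in> l \<and> c \<bullet> v = 1)"

definition properly_convex_in :: "real^'n \<Rightarrow> (real^'n) set set \<Rightarrow> bool" where
  "properly_convex_in c \<Omega> \<longleftrightarrow>
     c \<noteq> 0 \<and> \<Omega> \<subseteq> affine_chart c \<and>
     bounded (chart_coord c ` \<Omega>) \<and> convex (chart_coord c ` \<Omega>)"


subsection \<open>Indecomposability\<close>

text \<open>The preimage of \<open>\<Omega>\<close> in the vector space minus the origin consists of two opposite cones;
  this is the one on which \<open>c\<close> is positive.\<close>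

definition cone_over :: "real^'n \<Rightarrow> (real^'n) set set \<Rightarrow> (real^'n) set" where
  "cone_over c \<Omega> = {v. 0 < c \<bullet> v \<and> span {v} \<in> \<Omega>}"

text \<open>Convex cones are only required to be closed under positive scaling. The library's
  \<^const>\<open>cone\<close> and \<^const>\<open>convex_cone\<close> also contain the origin, which the cone over an open set
  does not; with those notions every domain would be indecomposable.\<close>

definition pos_convex_cone :: "(real^'n) set \<Rightarrow> bool" where
  "pos_convex_cone C \<longleftrightarrow> convex C \<and> (\<forall>v\<in>C. \<forall>t>0. t *\<^sub>R v \<in> C)"

definition decomposable_cone :: "(real^'n) set \<Rightarrow> bool" where
  "decomposable_cone C \<longleftrightarrow>
     (\<exists>V1 V2 C1 C2.
        subspace V1 \<and> subspace V2 \<and> dim V1 < CARD('n) \<and> dim V2 < CARD('n) \<and>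
        V1 \<inter> V2 = {0} \<and> {v1 + v2 | v1 v2. v1 \<in> V1 \<and> v2 \<in> V2} = UNIV \<and>
        C1 \<subseteq> V1 \<and> C2 \<subseteq> V2 \<and> pos_convex_cone C1 \<and> pos_convex_cone C2 \<and>
        C = {v1 + v2 | v1 v2. v1 \<in> C1 \<and> v2 \<in> C2})"

definition indecomposable_in :: "real^'n \<Rightarrow> (real^'n) set set \<Rightarrow> bool" where
  "indecomposable_in c \<Omega> \<longleftrightarrow> \<not> decomposable_cone (cone_over c \<Omega>)"


subsection \<open>The Hilbert metric\<close>

definition projective_line :: "(real^'n) set \<Rightarrow> (real^'n) set \<Rightarrow> (real^'n) set set" where
  "projective_line x y = {l \<in> projective_space. l \<subseteq> span (x \<union> y)}"

definition cross_ratio ::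
    "real^'n \<Rightarrow> (real^'n) set \<Rightarrow> (real^'n) set \<Rightarrow> (real^'n) set \<Rightarrow> (real^'n) set \<Rightarrow> real" where
  "cross_ratio c a x y b =
     (dist (chart_coord c a) (chart_coord c y) * dist (chart_coord c x) (chart_coord c b)) /
     (dist (chart_coord c a) (chart_coord c x) * dist (chart_coord c y) (chart_coord c b))"

text \<open>Exchanging \<open>a\<close> and \<open>b\<close> inverts the cross ratio, so the value does not depend on which of
  the two boundary points is called \<open>a\<close>.\<close>

definition hilbert_dist ::
    "real^'n \<Rightarrow> (real^'n) set set \<Rightarrow> (real^'n) set \<Rightarrow> (real^'n) set \<Rightarrow> real" where
  "hilbert_dist c \<Omega> x y =
     (if x = y then 0
      else THE d. \<exists>a b. a \<noteq> b \<and>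
             projective_line x y \<inter> projective_topology frontier_of \<Omega> = {a, b} \<and>
             d = 1 / 2 * \<bar>ln (cross_ratio c a x y b)\<bar>)"


subsection \<open>The projective special linear group and dividing groups\<close>

definition SL :: "(real^'n^'n) monoid" where
  "SL = \<lparr>carrier = {A. det A = 1}, mult = (**), one = mat 1\<rparr>"

definition SL_scalars :: "(real^'n^'n) set" where
  "SL_scalars = {A \<in> carrier SL. \<exists>r. A = mat r}"

definition PSL :: "(real^'n^'n) set monoid" where
  "PSL = SL Mod SL_scalars"

definition PSL_topology :: "(real^'n^'n) set topology" where
  "PSL_topology = quotient_topology (top_of_set (carrier SL)) (\<lambda>A. SL_scalars #>\<^bsub>SL\<^esub> A)"

lemma group_SL: "group (SL :: (real^'n^'n) monoid)"
proof (rule groupI)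
  fix A :: "real^'n^'n" assume "A \<in> carrier SL"
  then have d: "det A = 1" by (simp add: SL_def)
  then have "invertible A" by (simp add: invertible_det_nz)
  then obtain B where B: "B ** A = mat 1" by (auto simp: invertible_def)
  then have "det B * det A = 1" by (metis det_I det_mul)
  then show "\<exists>B\<in>carrier SL. B \<otimes>\<^bsub>SL\<^esub> A = \<one>\<^bsub>SL\<^esub>"
    using B d by (auto simp: SL_def)
qed (auto simp: SL_def det_mul matrix_mul_assoc)

lemma topspace_PSL_topology: "topspace PSL_topology = carrier PSL"
  by (simp add: PSL_topology_def PSL_def topspace_quotient_topology carrier_FactGroup)

text \<open>An element \<open>g\<close> of \<^const>\<open>PSL\<close> is a coset of matrices all of which induce the same map on
  lines, so the union over the coset is the image of \<open>l\<close> under any representative.\<close>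

definition proj_act :: "(real^'n^'n) set \<Rightarrow> (real^'n) set \<Rightarrow> (real^'n) set" where
  "proj_act g l = (\<Union>A\<in>g. (\<lambda>v. A *v v) ` l)"

definition Aut :: "(real^'n) set set \<Rightarrow> (real^'n^'n) set set" where
  "Aut \<Omega> = {g \<in> carrier PSL. proj_act g ` \<Omega> = \<Omega>}"

definition discrete_subgroup_PSL :: "(real^'n^'n) set set \<Rightarrow> bool" where
  "discrete_subgroup_PSL \<Gamma> \<longleftrightarrow>
     subgroup \<Gamma> PSL \<and> subtopology PSL_topology \<Gamma> = discrete_topology \<Gamma>"

definition properly_discontinuous_on ::
    "(real^'n^'n) set set \<Rightarrow> (real^'n) set set \<Rightarrow> bool" where
  "properly_discontinuous_on \<Gamma> \<Omega> \<longleftrightarrow>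
     (\<forall>K \<subseteq> \<Omega>. compactin projective_topology K \<longrightarrow>
        finite {\<gamma> \<in> \<Gamma>. proj_act \<gamma> ` K \<inter> K \<noteq> {}})"

definition cocompact_on :: "(real^'n^'n) set set \<Rightarrow> (real^'n) set set \<Rightarrow> bool" where
  "cocompact_on \<Gamma> \<Omega> \<longleftrightarrow>
     compact_space (quotient_topology (subtopology projective_topology \<Omega>)
                      (\<lambda>x. (\<lambda>\<gamma>. proj_act \<gamma> x) ` \<Gamma>))"

definition divides :: "(real^'n^'n) set set \<Rightarrow> (real^'n) set set \<Rightarrow> bool" where
  "divides \<Gamma> \<Omega> \<longleftrightarrow>
     discrete_subgroup_PSL \<Gamma> \<and> \<Gamma> \<subseteq> Aut \<Omega> \<and>
     properly_discontinuous_on \<Gamma> \<Omega> \<and> cocompact_on \<Gamma> \<Omega>"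


subsection \<open>The critical exponent\<close>

text \<open>The terms are nonnegative, so unconditional summability over \<open>\<Gamma>\<close> is convergence
  in the usual sense.\<close>

definition poincare_converges ::
    "real^'n \<Rightarrow> (real^'n) set set \<Rightarrow> (real^'n^'n) set set \<Rightarrow>
     (real^'n) set \<Rightarrow> (real^'n) set \<Rightarrow> real \<Rightarrow> bool" where
  "poincare_converges c \<Omega> \<Gamma> x y s \<longleftrightarrow>
     (\<lambda>\<gamma>. exp (- s * hilbert_dist c \<Omega> x (proj_act \<gamma> y))) summable_on \<Gamma>"

definition critical_exponent ::
    "real^'n \<Rightarrow> (real^'n) set set \<Rightarrow> (real^'n^'n) set set \<Rightarrow> real" where
  "critical_exponent c \<Omega> \<Gamma> =
     (THE \<delta>. 0 \<le> \<delta> \<and>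
        (\<forall>x\<in>\<Omega>. \<forall>y\<in>\<Omega>. \<forall>s\<ge>0.
           (s > \<delta> \<longrightarrow> poincare_converges c \<Omega> \<Gamma> x y s) \<and>
           (s < \<delta> \<longrightarrow> \<not> poincare_converges c \<Omega> \<Gamma> x y s)))"

end

theory Submission
  imports Defs
begin

text \<open>
  The Hilbert metric is geodesic along straight segments and \<open>\<Gamma>\<close> acts cocompactly, so an orbit point
  at distance \<open>R + S\<close> from \<open>x\<close> is reached through an orbit point at distance about \<open>R\<close>. With
  \<open>N(R) = #{\<gamma> \<in> \<Gamma>. d(x, \<gamma>x) \<le> R}\<close> this gives \<open>N(R + S) \<le> N(R + D) N(S + D)\<close> for some constant \<open>D\<close>,
  hence \<open>M(R) = N(R + 2D)\<close> is submultiplicative. If the Poincare series converged at some \<open>s > 0\<close>,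
  then \<open>N(R) exp (-sR)\<close> would tend to \<open>0\<close>, so \<open>M(n) < exp (sn)\<close> for some \<open>n\<close>; by
  submultiplicativity the series would still converge slightly below \<open>s\<close>. So the set of exponents
  of convergence is open, and the critical exponent does not belong to it. Convergence at \<open>s = 0\<close>
  is excluded because \<open>\<Gamma>\<close> is infinite, \<open>\<Omega>\<close> being unbounded for the Hilbert metric.
\<close>

section \<open>Submultiplicative growth and critical exponents\<close>

text \<open>A bound N(R) <= K exp (sR) would not suffice: passing from N to M costs the factor exp
  (2sD), and only the decay of N(R) exp (-sR) to 0 absorbs it. On the geometric side the obstacle is
  the cross ratio, which shows neither the triangle inequality nor invariance under \<Gamma>.
  Distances are instead read off the order of the cone C over \<Omega>: for representatives u, v,
  the supremum of t * s over pairs t, s > 0 with u - t v and v - s u in C is exp (-2d). Such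
  relations compose by adding elements of C and survive every linear map that sends C into itself.
  The cross ratio is then used for points at a prescribed distance along a line. The critical
  exponent is a definite description over all base points, so its value has to be exhibited and
  shown unique before divergence there can be stated.\<close>

lemma summable_of_submultiplicative_count:
  fixes f :: "'a \<Rightarrow> real" and M :: "real \<Rightarrow> real"
  assumes f: "\<And>g. g \<in> G \<Longrightarrow> 0 \<le> f g"
    and fin: "\<And>R. finite {g \<in> G. f g \<le> R}"
    and count: "\<And>R. 0 \<le> R \<Longrightarrow> real (card {g \<in> G. f g \<le> R}) \<le> M R"
    and M: "\<And>R S. 0 \<le> R \<Longrightarrow> 0 \<le> S \<Longrightarrow> M (R + S) \<le> M R * M S"
    and n: "0 < n" "M n < exp (s * n)" and s: "0 \<le> s"
  shows "(\<lambda>g. exp (- s * f g)) summable_on G"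
proof -
  \<comment> \<open>The ratio of the geometric series below; \<open>q < 1\<close> is the hypothesis
    on \<open>M n\<close> rewritten.\<close>
  define q where "q = M n * exp (- s * n)"
  have M0: "0 \<le> M R" if "0 \<le> R" for R
    using count[OF that] by (rule order_trans[rotated]) simp
  have q: "0 \<le> q" "q < 1"
    using n M0[of n] by (auto simp: q_def exp_minus field_simps)
  \<comment> \<open>The powers start at 1: nothing bounds \<open>M 0\<close> by 1.\<close>
  have pow: "M (real (Suc k) * n) \<le> M n ^ Suc k" for k
  proof (induction k)
    case (Suc k)
    have "M (real (Suc (Suc k)) * n) \<le> M n * M (real (Suc k) * n)"
      using M[of n "real (Suc k) * n"] n by (simp add: algebra_simps)
    also have "\<dots> \<le> M n * M n ^ Suc k"
      using Suc M0[of n] n by (intro mult_left_mono) auto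
    finally show ?case by simp
  qed simp
  \<comment> \<open>Cuts \<open>G\<close> into shells of width \<open>n\<close>. A shell is counted
    with its outer radius and weighted with its inner one, which costs a single extra factor
    \<open>M n\<close>.\<close>
  define k where "k g = nat \<lfloor>f g / n\<rfloor>" for g
  have k: "real (k g) * n \<le> f g" "f g \<le> real (Suc (k g)) * n" if "g \<in> G" for g
  proof -
    have "real (k g) \<le> f g / n" "f g / n \<le> real (Suc (k g))"
      using f[OF that] n(1) unfolding k_def by (simp_all, linarith+)
    then show "real (k g) * n \<le> f g" "f g \<le> real (Suc (k g)) * n"
      using n(1) by (simp_all add: field_simps)
  qed
  have bound: "(\<Sum>g\<in>F. exp (- s * f g)) \<le> M n / (1 - q)"
    if F: "finite F" "F \<subseteq> G" for F
  proof -
    have shell: "(\<Sum>g\<in>{g\<in>F. k g = j}. exp (- s * f g)) \<le> M n * q ^ j" for j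
    proof -
      have "(\<Sum>g\<in>{g\<in>F. k g = j}. exp (- s * f g))
          \<le> (\<Sum>g\<in>{g\<in>F. k g = j}. exp (- s * (real j * n)))"
        using k(1) F s by (intro sum_mono) (auto intro!: mult_left_mono)
      also have "\<dots> = real (card {g\<in>F. k g = j}) * exp (- s * (real j * n))" by simp
      also have "\<dots> \<le> M n ^ Suc j * exp (- s * (real j * n))"
      proof (intro mult_right_mono)
        have "card {g\<in>F. k g = j} \<le> card {g\<in>G. f g \<le> real (Suc j) * n}"
          using F(2) k(2) by (intro card_mono fin) blast
        then show "real (card {g\<in>F. k g = j}) \<le> M n ^ Suc j"
          using count[of "real (Suc j) * n"] pow[of j] n by simp
      qed simp
      also have "exp (- s * (real j * n)) = exp (- s * n) ^ j"
        by (simp add: exp_of_nat_mult [symmetric] algebra_simps)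
      also have "M n ^ Suc j * exp (- s * n) ^ j = M n * q ^ j"
        by (simp add: q_def power_mult_distrib)
      finally show ?thesis .
    qed
    have "(\<Sum>g\<in>F. exp (- s * f g)) = (\<Sum>j\<in>k ` F. \<Sum>g\<in>{g\<in>F. k g = j}. exp (- s * f g))"
      using F(1) by (rule sum.image_gen)
    also have "\<dots> \<le> (\<Sum>j\<in>k ` F. M n * q ^ j)" by (intro sum_mono shell)
    also have "\<dots> = M n * (\<Sum>j\<in>k ` F. q ^ j)" by (simp add: sum_distrib_left)
    also have "\<dots> \<le> M n * (\<Sum>j. q ^ j)"
      using q F M0[of n] n by (intro mult_left_mono sum_le_suminf summable_geometric) auto
    also have "\<dots> = M n / (1 - q)" using q by (simp add: suminf_geometric)
    finally show ?thesis .
  qed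
  show ?thesis
    by (intro nonneg_bdd_above_summable_on bdd_aboveI2[where M = "M n / (1 - q)"] bound) auto
qed

text \<open>Outside a finite set \<open>F\<close> the series has sum at most \<open>e / 2\<close>,
  and each element counted there contributes at least \<open>exp (- s * R)\<close>; the elements of
  \<open>F\<close> are fixed in number and are outgrown by \<open>exp (s * R)\<close>, since
  \<open>s > 0\<close>.\<close>

lemma count_small_of_summable:
  fixes f :: "'a \<Rightarrow> real"
  assumes sum: "(\<lambda>g. exp (- s * f g)) summable_on G" and s: "0 < s" and e: "0 < e"
    and fin: "\<And>R. finite {g \<in> G. f g \<le> R}"
  shows "\<exists>R0. \<forall>R\<ge>R0. real (card {g \<in> G. f g \<le> R}) \<le> e * exp (s * R)"
proof -
  obtain F where F: "finite F" "F \<subseteq> G"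
    and tail: "dist (\<Sum>g\<in>F. exp (- s * f g)) (\<Sum>\<^sub>\<infinity>g\<in>G. exp (- s * f g)) \<le> e / 2"
    using infsum_finite_approximation[OF sum, of "e / 2"] e by auto
  \<comment> \<open>Beyond \<open>R0\<close>, \<open>card F\<close> is at most half of the allowed
    bound. The \<open>+ 1\<close> keeps the argument of \<open>ln\<close> positive when
    \<open>F\<close> is empty.\<close>
  define R0 where "R0 = ln (2 * (real (card F) + 1) / e) / s"
  have "real (card {g \<in> G. f g \<le> R}) \<le> e * exp (s * R)" if R: "R0 \<le> R" for R
  proof -
    let ?A = "{g \<in> G. f g \<le> R}"
    have "ln (2 * (real (card F) + 1) / e) \<le> s * R"
      using R s by (simp add: R0_def field_simps)
    then have "2 * (real (card F) + 1) / e \<le> exp (s * R)"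
      using e by (metis exp_le_cancel_iff exp_ln add_nonneg_pos divide_pos_pos mult_pos_pos
          of_nat_0_le_iff zero_less_numeral zero_less_one)
    then have cF: "real (card F) \<le> e / 2 * exp (s * R)"
      using e by (simp add: field_simps)
    have "real (card (?A - F)) * exp (- s * R) = (\<Sum>g\<in>?A - F. exp (- s * R))" by simp
    also have "\<dots> \<le> (\<Sum>g\<in>?A - F. exp (- s * f g))"
      using s by (intro sum_mono) auto
    also have "\<dots> = (\<Sum>g\<in>(?A - F) \<union> F. exp (- s * f g)) - (\<Sum>g\<in>F. exp (- s * f g))"
      using F fin by (subst sum.union_disjoint) auto
    also have "\<dots> \<le> (\<Sum>\<^sub>\<infinity>g\<in>G. exp (- s * f g)) - (\<Sum>g\<in>F. exp (- s * f g))"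
      using F fin by (intro diff_right_mono finite_sum_le_infsum[OF sum]) auto
    also have "\<dots> \<le> e / 2" using tail unfolding dist_real_def by linarith
    finally have cA: "real (card (?A - F)) \<le> e / 2 * exp (s * R)"
      by (simp add: exp_minus field_simps)
    have "card ?A \<le> card F + card (?A - F)"
      using F fin by (metis card_Un_le card_mono finite_Diff finite_UnI le_trans
          Un_Diff_cancel Un_upper2 order_refl)
    then have "real (card ?A) \<le> real (card F) + real (card (?A - F))" by linarith
    then show ?thesis using cF cA by (simp add: field_simps)
  qed
  then show ?thesis by blast
qed

text \<open>The set of exponents of convergence is upward closed, nonempty, omits 0 and contains
  with each element a smaller one. It is therefore an open half-line whose infimum \<delta> it does
  not contain.\<close>

lemma critical_exponent_of_submultiplicative:
  fixes f :: "'a \<Rightarrow> real" and G :: "'a set"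
  defines "N \<equiv> (\<lambda>R. real (card {g \<in> G. f g \<le> R}))"
  assumes f: "\<And>g. g \<in> G \<Longrightarrow> 0 \<le> f g"
    and fin: "\<And>R. finite {g \<in> G. f g \<le> R}"
    and inf: "infinite G"
    and D: "0 \<le> D"
    and sub: "\<And>R S. 0 \<le> R \<Longrightarrow> 0 \<le> S \<Longrightarrow> N (R + S) \<le> N (R + D) * N (S + D)"
  obtains \<delta> where "0 \<le> \<delta>"
    "\<And>s. 0 \<le> s \<Longrightarrow> ((\<lambda>g. exp (- s * f g)) summable_on G) = (\<delta> < s)"
proof -
  \<comment> \<open>One shift by \<open>D\<close> for each of the two radii on the left of
    \<open>sub\<close>, and one more that \<open>sub\<close> adds on the right: (R + D) + (S + D) is
    bounded through R + 2D and S + 2D.\<close>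
  define M where "M R = N (R + 2 * D)" for R
  define P where "P s \<longleftrightarrow> (\<lambda>g. exp (- s * f g)) summable_on G" for s
  have N_mono: "N R \<le> N S" if "R \<le> S" for R S
    using that by (auto simp: N_def intro!: card_mono fin)
  have P_iff: "P s" if "0 \<le> s" "0 < n" "M n < exp (s * n)" for s n
    unfolding P_def
  proof (rule summable_of_submultiplicative_count[where M = M and n = n, OF f fin])
    show "real (card {g \<in> G. f g \<le> R}) \<le> M R" for R
      using N_mono[of R "R + 2 * D"] D by (simp add: M_def N_def)
    show "M (R + S) \<le> M R * M S" if "0 \<le> R" "0 \<le> S" for R S
      using sub[of "R + D" "S + D"] that D by (simp add: M_def algebra_simps)
  qed (use that in auto)
  have P_mono: "P t" if "P s" "s \<le> t" for s t
    unfolding P_def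
    by (rule summable_on_comparison_test[OF that(1)[unfolded P_def]])
      (use f that in \<open>auto intro!: mult_right_mono\<close>)
  have not_P0: "\<not> P 0"
    using inf infsum_diverge_constant[of G "1::real"] by (simp add: P_def)
  have P_open: "\<exists>t. 0 \<le> t \<and> t < s \<and> P t" if Ps: "P s" and s: "0 \<le> s" for s
  proof -
    have s0: "0 < s" using not_P0 Ps s by (cases "s = 0") auto
    \<comment> \<open>The exponential factor cancels the shift by 2D in \<open>M n\<close>; the
      factor 1/2 makes the resulting inequality strict.\<close>
    obtain R0 where R0: "\<And>R. R0 \<le> R \<Longrightarrow> N R \<le> exp (- s * (2 * D)) / 2 * exp (s * R)"
      using count_small_of_summable[OF Ps[unfolded P_def] s0 _ fin, of "exp (- s * (2 * D)) / 2"]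
      by (auto simp: N_def)
    define n where "n = max 1 R0"
    have n: "0 < n" "R0 \<le> n + 2 * D" using D by (auto simp: n_def)
    have "M n \<le> exp (- s * (2 * D)) / 2 * exp (s * (n + 2 * D))"
      unfolding M_def by (rule R0[OF n(2)])
    also have "\<dots> = exp (s * n) / 2"
      by (simp add: exp_minus exp_add distrib_left field_simps)
    also have "\<dots> < exp (s * n)" by simp
    finally have "M n < exp (s * n)" .
    \<comment> \<open>With \<open>n\<close> fixed, the strict inequality persists for
      \<open>t\<close> slightly below \<open>s\<close>.\<close>
    moreover have "((\<lambda>t. exp (t * n)) \<longlongrightarrow> exp (s * n)) (at_left s)"
      by (intro tendsto_intros)
    ultimately have "eventually (\<lambda>t. M n < exp (t * n)) (at_left s)"
      by (rule order_tendstoD(1)[rotated])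
    moreover have "eventually (\<lambda>t. t \<in> {0<..<s}) (at_left s)"
      using s0 by (rule eventually_at_left_real)
    ultimately have "eventually (\<lambda>t. 0 \<le> t \<and> t < s \<and> P t) (at_left s)"
      by eventually_elim (use n P_iff in auto)
    then show ?thesis
      using eventually_happens trivial_limit_at_left_real by blast
  qed
  define \<delta> where "\<delta> = Inf {s. 0 \<le> s \<and> P s}"
  \<comment> \<open>Some exponent of convergence exists: take n = 1 and s = \<open>M 1\<close>,
    since a < exp a for every real a.\<close>
  have "M 1 < exp (M 1 * 1)"
    unfolding mult_1_right using exp_ge_add_one_self[of "M 1"] by linarith
  moreover have "0 \<le> M 1" by (simp add: M_def N_def)
  ultimately have ne: "M 1 \<in> {s. 0 \<le> s \<and> P s}" using P_iff[of "M 1" 1] by simp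
  have bdd: "bdd_below {s. 0 \<le> s \<and> P s}" by (intro bdd_belowI[of _ 0]) auto
  show thesis
  proof (rule that)
    show "0 \<le> \<delta>" unfolding \<delta>_def using ne by (intro cInf_greatest) auto
    fix s :: real assume s: "0 \<le> s"
    have "P s \<longleftrightarrow> \<delta> < s"
    proof
      assume "P s"
      then obtain t where "0 \<le> t" "t < s" "P t" using P_open s by blast
      then show "\<delta> < s" unfolding \<delta>_def by (intro le_less_trans[OF cInf_lower[OF _ bdd]]) auto
    next
      assume "\<delta> < s"
      then obtain t where "t \<in> {s. 0 \<le> s \<and> P s}" "t < s"
        unfolding \<delta>_def using cInf_lessD[of "{s. 0 \<le> s \<and> P s}" s] ne by blast
      then show "P s" using P_mono[of t s] by auto
    qed
    then show "((\<lambda>g. exp (- s * f g)) summable_on G) = (\<delta> < s)" by (simp add: P_def)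
  qed
qed


section \<open>The cone over a properly convex domain\<close>

lemma span_scaleR: "k \<noteq> 0 \<Longrightarrow> span {k *\<^sub>R v} = span {v :: 'a::real_vector}"
proof -
  assume k: "k \<noteq> 0"
  show ?thesis
  proof (intro span_eq[THEN iffD2] conjI)
    have "v = (1 / k) *\<^sub>R k *\<^sub>R v" using k by simp
    then show "{v} \<subseteq> span {k *\<^sub>R v}" using span_scale span_base by (metis singletonI empty_subsetI insert_subset)
  qed (simp add: span_scale span_base)
qed

lemma span_singleton_eqD:
  fixes v w :: "'a::real_vector"
  assumes "span {v} = span {w}" "w \<noteq> 0"
  obtains k where "k \<noteq> 0" "w = k *\<^sub>R v"
proof -
  have "w \<in> span {v}" using assms(1) by (simp add: span_base)
  then obtain k where "w = k *\<^sub>R v" by (auto simp: span_singleton)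
  moreover have "k \<noteq> 0" using calculation assms(2) by auto
  ultimately show thesis using that by blast
qed

lemma projective_spaceE:
  assumes "l \<in> projective_space"
  obtains v where "v \<noteq> 0" "l = span {v}"
  using assms by (auto simp: projective_space_def)

lemma span_in_projective_space: "v \<noteq> 0 \<Longrightarrow> span {v} \<in> projective_space"
  by (auto simp: projective_space_def)

lemma chart_coord_span:
  assumes "c \<bullet> v \<noteq> 0"
  shows "chart_coord c (span {v}) = (1 / (c \<bullet> v)) *\<^sub>R v"
  unfolding chart_coord_def
  by (rule the_equality) (use assms in \<open>auto simp: span_singleton field_simps\<close>)

lemma openin_projective_topology:
  "openin projective_topology (U :: (real^'n) set set) \<longleftrightarrow>
     U \<subseteq> projective_space \<and> open {v. v \<noteq> 0 \<and> span {v} \<in> U}"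
proof -
  have "{x \<in> - {0}. span {x} \<in> U} = {v :: real^'n. v \<noteq> 0 \<and> span {v} \<in> U}" by auto
  moreover have "openin (top_of_set (- {0 :: real^'n})) V \<longleftrightarrow> open V" if "V \<subseteq> - {0}" for V
    using that by (simp add: openin_open_eq open_Compl)
  ultimately show ?thesis
    by (simp add: projective_topology_def openin_quotient_topology projective_space_def subset_eq
        del: mem_Collect_eq)
qed

lemma continuous_map_span:
  "continuous_map (top_of_set (- {0 :: real^'n})) projective_topology (\<lambda>v. span {v})"
  unfolding projective_topology_def
  by (rule quotient_imp_continuous_map[OF quotient_map_quotient_topology])

lemma compactin_span_image:
  assumes "compact K" "(0 :: real^'n) \<notin> K"
  shows "compactin projective_topology ((\<lambda>v. span {v}) ` K)"
  by (rule image_compactin[OF _ continuous_map_span])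
    (use assms in \<open>auto simp: compactin_subtopology\<close>)

locale properly_convex_domain =
  fixes \<Omega> :: "(real^'n) set set" and c :: "real^'n"
  assumes domain: "projective_domain \<Omega>"
    and properly_convex: "properly_convex_in c \<Omega>"
begin

abbreviation "C \<equiv> cone_over c \<Omega>"

lemma cone_pos: "v \<in> C \<Longrightarrow> 0 < c \<bullet> v"
  by (simp add: cone_over_def)

lemma cone_nonzero: "v \<in> C \<Longrightarrow> v \<noteq> 0"
  using cone_pos by fastforce

lemma cone_span: "v \<in> C \<Longrightarrow> span {v} \<in> \<Omega>"
  by (simp add: cone_over_def)

lemma cone_scale: "v \<in> C \<Longrightarrow> 0 < k \<Longrightarrow> k *\<^sub>R v \<in> C"
  by (simp add: cone_over_def span_scaleR)

lemma cone_scale_iff: "0 < k \<Longrightarrow> k *\<^sub>R v \<in> C \<longleftrightarrow> v \<in> C"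
  by (simp add: cone_over_def span_scaleR zero_less_mult_iff)

lemma domain_repE:
  assumes "x \<in> \<Omega>"
  obtains v where "v \<in> C" "c \<bullet> v = 1" "x = span {v}"
proof -
  have "x \<in> affine_chart c" using assms properly_convex by (auto simp: properly_convex_in_def)
  then obtain w v where x: "x = span {w}" "v \<in> x" "c \<bullet> v \<noteq> 0" "w \<noteq> 0"
    by (auto simp: affine_chart_def elim!: projective_spaceE)
  then obtain k where k: "v = k *\<^sub>R w" by (auto simp: span_singleton)
  have "k \<noteq> 0" using x k by auto
  then have "x = span {(1 / (c \<bullet> v)) *\<^sub>R v}" using x k by (simp add: span_scaleR del: scaleR_scaleR)
  then show thesis
    by (intro that[of "(1 / (c \<bullet> v)) *\<^sub>R v"]) (use assms x in \<open>auto simp: cone_over_def\<close>)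
qed

text \<open>The nonzero vectors over \<Omega> form the two opposite cones C and -C. This sign
  ambiguity returns in every passage from lines to vectors.\<close>

lemma span_in_domain_iff: "span {v} \<in> \<Omega> \<longleftrightarrow> v \<in> C \<or> - v \<in> C"
proof
  assume v: "span {v} \<in> \<Omega>"
  obtain w where w: "w \<in> C" "c \<bullet> w = 1" "span {v} = span {w}" by (rule domain_repE[OF v])
  obtain k where k: "k \<noteq> 0" "w = k *\<^sub>R v"
    using span_singleton_eqD[OF w(3)] cone_nonzero[OF w(1)] by blast
  have "v = (1 / k) *\<^sub>R w" "- v = (- 1 / k) *\<^sub>R w" using k by simp_all
  then show "v \<in> C \<or> - v \<in> C"
    using cone_scale[OF w(1), of "1 / k"] cone_scale[OF w(1), of "- 1 / k"] k(1)
    by (cases "0 < k") auto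
next
  assume "v \<in> C \<or> - v \<in> C"
  then show "span {v} \<in> \<Omega>"
    using cone_span[of v] cone_span[of "- v"] span_scaleR[of "-1" v] by auto
qed

lemma domain_subset: "\<Omega> \<subseteq> projective_space"
  using properly_convex by (auto simp: properly_convex_in_def affine_chart_def)

lemma domain_openin: "openin projective_topology \<Omega>"
  using domain by (simp add: projective_domain_def)

lemma cone_open: "open C"
proof -
  have "C = {v. v \<noteq> 0 \<and> span {v} \<in> \<Omega>} \<inter> {v. 0 < c \<bullet> v}"
    by (auto simp: cone_over_def)
  moreover have "open {v. v \<noteq> 0 \<and> span {v} \<in> \<Omega>}"
    using domain_openin by (simp add: openin_projective_topology)
  moreover have "open {v. 0 < c \<bullet> v}" by (rule open_halfspace_gt)
  ultimately show ?thesis by (simp add: open_Int)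
qed

lemma in_cone_iff:
  assumes "0 < c \<bullet> v"
  shows "v \<in> C \<longleftrightarrow> (1 / (c \<bullet> v)) *\<^sub>R v \<in> chart_coord c ` \<Omega>"
proof
  assume v: "v \<in> C"
  then show "(1 / (c \<bullet> v)) *\<^sub>R v \<in> chart_coord c ` \<Omega>"
    using cone_span[OF v] chart_coord_span[of c v] assms by force
next
  assume "(1 / (c \<bullet> v)) *\<^sub>R v \<in> chart_coord c ` \<Omega>"
  then obtain x where x: "x \<in> \<Omega>" "(1 / (c \<bullet> v)) *\<^sub>R v = chart_coord c x" by blast
  then obtain w where w: "w \<in> C" "c \<bullet> w = 1" "x = span {w}" by (auto elim: domain_repE)
  then have "(1 / (c \<bullet> v)) *\<^sub>R v = w" using x by (simp add: chart_coord_span)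
  then show "v \<in> C" using w(1) cone_scale_iff[of "1 / (c \<bullet> v)" v] assms by simp
qed

lemma cone_add:
  assumes "u \<in> C" "v \<in> C"
  shows "u + v \<in> C"
proof -
  let ?a = "c \<bullet> u" and ?b = "c \<bullet> v"
  have pos: "0 < ?a" "0 < ?b" using assms cone_pos by auto
  have cv: "convex (chart_coord c ` \<Omega>)" using properly_convex by (simp add: properly_convex_in_def)
  \<comment> \<open>The normalisation of u + v is the convex combination of the normalised u and v
    with weights proportional to their heights under \<open>c\<close>.\<close>
  have "(?a / (?a + ?b)) *\<^sub>R ((1 / ?a) *\<^sub>R u) + (?b / (?a + ?b)) *\<^sub>R ((1 / ?b) *\<^sub>R v)
      \<in> chart_coord c ` \<Omega>"
    by (rule convexD[OF cv]) (use assms pos in_cone_iff in \<open>auto simp: add_divide_distrib[symmetric]\<close>)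
  also have "(?a / (?a + ?b)) *\<^sub>R ((1 / ?a) *\<^sub>R u) + (?b / (?a + ?b)) *\<^sub>R ((1 / ?b) *\<^sub>R v)
      = (1 / (c \<bullet> (u + v))) *\<^sub>R (u + v)"
    using pos by (simp add: inner_add_right scaleR_add_right)
  finally show ?thesis using in_cone_iff[of "u + v"] pos by (simp add: inner_add_right)
qed

text \<open>Boundedness of the chart image in homogeneous form. It makes \<open>c\<close> positive
  on all nonzero vectors of the closed cone, which excludes boundary points at infinity of the
  chart.\<close>

lemma cone_norm_bound: obtains B where "0 < B" "\<And>v. v \<in> closure C \<Longrightarrow> norm v \<le> B * (c \<bullet> v)"
proof -
  have "bounded (chart_coord c ` \<Omega>)" using properly_convex by (simp add: properly_convex_in_def)
  then obtain B where B: "0 < B" "\<And>v. v \<in> chart_coord c ` \<Omega> \<Longrightarrow> norm v \<le> B"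
    by (auto simp: bounded_pos)
  have "C \<subseteq> {v. norm v \<le> B * (c \<bullet> v)}"
  proof
    fix v assume v: "v \<in> C"
    then have "norm ((1 / (c \<bullet> v)) *\<^sub>R v) \<le> B" using B(2) in_cone_iff cone_pos by blast
    then show "v \<in> {v. norm v \<le> B * (c \<bullet> v)}"
      using cone_pos[OF v] by (simp add: field_simps)
  qed
  moreover have "closed {v. norm v \<le> B * (c \<bullet> v)}"
    by (intro closed_Collect_le continuous_intros)
  ultimately have "closure C \<subseteq> {v. norm v \<le> B * (c \<bullet> v)}" by (rule closure_minimal)
  then show thesis using that B(1) by blast
qed

text \<open>Replace \<open>v\<close> by a nearby \<open>w\<close> in C; the error
  \<open>b *\<^sub>R (v - w)\<close> is absorbed by a ball around \<open>a *\<^sub>R u\<close>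
  inside the open cone.\<close>

lemma cone_closure_segment:
  assumes "u \<in> C" "v \<in> closure C" "0 < a" "0 \<le> b"
  shows "a *\<^sub>R u + b *\<^sub>R v \<in> C"
proof -
  obtain e where e: "0 < e" "ball (a *\<^sub>R u) e \<subseteq> C"
    using cone_open cone_scale[OF assms(1,3)] by (meson openE)
  show ?thesis
  proof (cases "b = 0")
    case True
    then show ?thesis using cone_scale assms by simp
  next
    case False
    obtain w where w: "w \<in> C" "dist w v < e / b"
      using assms(2) e(1) False assms(4) by (metis closure_approachable divide_pos_pos less_eq_real_def)
    have "norm (b *\<^sub>R (v - w)) < e"
      using w(2) False assms(4)
      by (simp add: dist_norm norm_minus_commute pos_less_divide_eq mult.commute del: scaleR_diff_right)
    then have "a *\<^sub>R u + b *\<^sub>R (v - w) \<in> C"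
      using e(2) by (auto simp: dist_norm)
    then have "(a *\<^sub>R u + b *\<^sub>R (v - w)) + b *\<^sub>R w \<in> C"
      using cone_add cone_scale[OF w(1)] False assms(4) by simp
    then show ?thesis by (simp add: algebra_simps)
  qed
qed

lemma closure_cone_scale:
  assumes "w \<in> closure C" "0 < k"
  shows "k *\<^sub>R w \<in> closure C"
proof -
  have "(*\<^sub>R) k ` closure C = closure ((*\<^sub>R) k ` C)" by (rule closure_scaleR)
  also have "\<dots> \<subseteq> closure C" using cone_scale assms(2) by (intro closure_mono) auto
  finally show ?thesis using assms(1) by blast
qed

lemma closure_cone_scale_iff: "0 < k \<Longrightarrow> k *\<^sub>R w \<in> closure C \<longleftrightarrow> w \<in> closure C"
  using closure_cone_scale[of w k] closure_cone_scale[of "k *\<^sub>R w" "1 / k"] by auto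

section \<open>Closure of the domain in projective space and closure of its cone\<close>

lemma closure_of_domainD:
  assumes "v \<noteq> 0" "span {v} \<in> projective_topology closure_of \<Omega>"
  shows "v \<in> closure C \<or> - v \<in> closure C"
proof (rule ccontr)
  assume v: "\<not> ?thesis"
  let ?P = "{v. v \<notin> closure C \<and> - v \<notin> closure C}"
  have scale: "k *\<^sub>R w \<in> ?P" if "w \<in> ?P" "k \<noteq> 0" for k w
  proof (cases "0 < k")
    case True
    then show ?thesis
      using that closure_cone_scale_iff[of k w] closure_cone_scale_iff[of k "- w"] by simp
  next
    case False
    then show ?thesis
      using that closure_cone_scale_iff[of "- k" w] closure_cone_scale_iff[of "- k" "- w"] by simp
  qed
  have openP: "open ?P"
  proof -
    have "?P = - closure C \<inter> uminus -` (- closure C)" by auto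
    also have "open \<dots>" by (intro open_Int open_vimage continuous_intros open_Compl closed_closure)
    finally show ?thesis .
  qed
  \<comment> \<open>\<open>?P\<close> is open and stable under nonzero scaling, so its set of lines
    is a projective neighbourhood of \<open>span {v}\<close>; it misses \<Omega>.\<close>
  define U where "U = (\<lambda>w. span {w}) ` (?P - {0})"
  have "{w. w \<noteq> 0 \<and> span {w} \<in> U} = ?P - {0}"
  proof (intro equalityI subsetI)
    fix w assume "w \<in> {w. w \<noteq> 0 \<and> span {w} \<in> U}"
    then obtain u where u: "u \<in> ?P" "span {u} = span {w}" "w \<noteq> 0" by (auto simp: U_def)
    then obtain k where "k \<noteq> 0" "w = k *\<^sub>R u" by (auto elim: span_singleton_eqD)
    then show "w \<in> ?P - {0}" using scale[OF u(1)] u(3) by simp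
  qed (auto simp: U_def)
  then have "openin projective_topology U"
    using openP by (auto simp: openin_projective_topology open_delete U_def span_in_projective_space)
  moreover have "span {v} \<in> U" using v assms(1) by (auto simp: U_def)
  ultimately obtain y where y: "y \<in> \<Omega>" "y \<in> U" using assms(2) by (auto simp: in_closure_of)
  then obtain w where w: "w \<in> ?P" "y = span {w}" by (auto simp: U_def)
  then show False using y(1) span_in_domain_iff[of w] closure_subset by blast
qed

lemma closure_of_domainI:
  assumes "v \<noteq> 0" "v \<in> closure C"
  shows "span {v} \<in> projective_topology closure_of \<Omega>"
proof -
  have "- {0} \<inter> C = C" using cone_nonzero by auto
  then have "v \<in> top_of_set (- {0}) closure_of C"
    using assms by (simp add: closure_of_subtopology)
  then have "span {v} \<in> projective_topology closure_of ((\<lambda>v. span {v}) ` C)"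
    using continuous_map_image_closure_subset[OF continuous_map_span] by blast
  moreover have "(\<lambda>v. span {v}) ` C \<subseteq> \<Omega>" using cone_span by blast
  ultimately show ?thesis using closure_of_mono by blast
qed


subsection \<open>Birkhoff's description of the Hilbert metric\<close>

text \<open>The relation \<open>d(span {u}, span {v}) < R\<close> for representatives \<open>u, v \<in> C\<close>.
  Unlike the cross ratio, it makes the triangle inequality and projective invariance evident.\<close>

definition cone_close :: "real^'n \<Rightarrow> real^'n \<Rightarrow> real \<Rightarrow> bool" where
  "cone_close u v R \<longleftrightarrow>
     (\<exists>t>0. \<exists>s>0. u - t *\<^sub>R v \<in> C \<and> v - s *\<^sub>R u \<in> C \<and> exp (- 2 * R) < t * s)"

lemma cone_close_scale1:
  assumes "0 < k" "cone_close u v R"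
  shows "cone_close (k *\<^sub>R u) v R"
proof -
  obtain t s where ts: "0 < t" "0 < s" "u - t *\<^sub>R v \<in> C" "v - s *\<^sub>R u \<in> C" "exp (- 2 * R) < t * s"
    using assms(2) by (auto simp: cone_close_def)
  have "k *\<^sub>R u - (k * t) *\<^sub>R v \<in> C"
    using cone_scale[OF ts(3) assms(1)] by (simp add: algebra_simps)
  moreover have "v - (s / k) *\<^sub>R (k *\<^sub>R u) \<in> C" using ts assms(1) by simp
  moreover have "exp (- 2 * R) < (k * t) * (s / k)" using ts assms(1) by simp
  ultimately show ?thesis
    unfolding cone_close_def using ts assms(1) by (meson divide_pos_pos mult_pos_pos)
qed

lemma cone_close_sym: "cone_close u v R \<Longrightarrow> cone_close v u R"
  unfolding cone_close_def by (metis mult.commute)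

lemma cone_close_scale:
  assumes "0 < k" "0 < l"
  shows "cone_close (k *\<^sub>R u) (l *\<^sub>R v) R \<longleftrightarrow> cone_close u v R"
proof -
  have "cone_close (k *\<^sub>R u) (l *\<^sub>R v) R" if "cone_close u v R" "0 < k" "0 < l" for k l u v
    using that by (meson cone_close_scale1 cone_close_sym)
  from this[of u v k l] this[of "k *\<^sub>R u" "l *\<^sub>R v" "1 / k" "1 / l"] show ?thesis
    using assms by auto
qed

text \<open>In the order of the cone, u > t v and v > t' w give u > t t' w: factors multiply, so
  their logarithms add.\<close>

lemma cone_close_trans:
  assumes "cone_close u v R" "cone_close v w S"
  shows "cone_close u w (R + S)"
proof -
  obtain t s where ts: "0 < t" "0 < s" "u - t *\<^sub>R v \<in> C" "v - s *\<^sub>R u \<in> C" "exp (- 2 * R) < t * s"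
    using assms(1) by (auto simp: cone_close_def)
  obtain t' s' where ts': "0 < t'" "0 < s'" "v - t' *\<^sub>R w \<in> C" "w - s' *\<^sub>R v \<in> C" "exp (- 2 * S) < t' * s'"
    using assms(2) by (auto simp: cone_close_def)
  have "u - (t * t') *\<^sub>R w \<in> C"
    using cone_add[OF ts(3) cone_scale[OF ts'(3) ts(1)]] by (simp add: algebra_simps)
  moreover have "w - (s' * s) *\<^sub>R u \<in> C"
    using cone_add[OF ts'(4) cone_scale[OF ts(4) ts'(2)]] by (simp add: algebra_simps)
  moreover have "exp (- 2 * (R + S)) < (t * t') * (s' * s)"
  proof -
    have "exp (- 2 * (R + S)) = exp (- 2 * R) * exp (- 2 * S)" by (simp add: exp_add[symmetric] algebra_simps)
    also have "\<dots> < (t * s) * (t' * s')" using ts ts' by (intro mult_strict_mono) auto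
    finally show ?thesis by (simp add: ac_simps)
  qed
  ultimately show ?thesis unfolding cone_close_def using ts ts' by (meson mult_pos_pos)
qed

lemma cone_close_refl:
  assumes "u \<in> C" "0 < R"
  shows "cone_close u u R"
proof -
  \<comment> \<open>Any t < 1 with t * t > exp (-2R) would do; t < 1 keeps (1 - t) u in the open
    cone.\<close>
  define t where "t = exp (- R / 2)"
  have t: "0 < t" "t < 1" "t * t = exp (- R)"
    using assms(2) by (simp_all add: t_def exp_add[symmetric] del: exp_le_cancel_iff)
  have "u - t *\<^sub>R u \<in> C" using cone_scale[OF assms(1), of "1 - t"] t by (simp add: algebra_simps)
  moreover have "exp (- 2 * R) < t * t" using t assms(2) by simp
  ultimately show ?thesis using t unfolding cone_close_def by blast
qed

lemma cone_close_pos: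
  assumes "u \<in> C" "cone_close u v R"
  shows "0 < R"
proof -
  obtain t s where ts: "0 < t" "0 < s" "u - t *\<^sub>R v \<in> C" "v - s *\<^sub>R u \<in> C" "exp (- 2 * R) < t * s"
    using assms(2) by (auto simp: cone_close_def)
  \<comment> \<open>Eliminating \<open>v\<close> leaves (1 - t s) u in the cone, hence t s <
    1.\<close>
  have "(u - t *\<^sub>R v) + t *\<^sub>R (v - s *\<^sub>R u) \<in> C" using ts by (intro cone_add cone_scale)
  then have "0 < c \<bullet> ((u - t *\<^sub>R v) + t *\<^sub>R (v - s *\<^sub>R u))" by (rule cone_pos)
  also have "\<dots> = (1 - t * s) * (c \<bullet> u)" by (simp add: inner_diff_right inner_add_right algebra_simps)
  finally have "t * s < 1" using cone_pos[OF assms(1)] by (simp add: zero_less_mult_iff)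
  then have "exp (- 2 * R) < exp 0" using ts(5) unfolding exp_zero by linarith
  then show ?thesis unfolding exp_less_cancel_iff by simp
qed

text \<open>The line through the normalised points is parametrised with p at 0 and q at 1; \<alpha>
  and \<beta> are the parameters of its two boundary points.\<close>

definition chord :: "real^'n \<Rightarrow> real^'n \<Rightarrow> real \<Rightarrow> real \<Rightarrow> bool" where
  "chord p q \<alpha> \<beta> \<longleftrightarrow> c \<bullet> p = 1 \<and> c \<bullet> q = 1 \<and> p \<noteq> q \<and> p \<in> C \<and> q \<in> C \<and>
     (\<forall>\<tau>. p + \<tau> *\<^sub>R (q - p) \<in> C \<longleftrightarrow> \<alpha> < \<tau> \<and> \<tau> < \<beta>)"

lemma chord_bounds: "chord p q \<alpha> \<beta> \<Longrightarrow> \<alpha> < 0 \<and> 1 < \<beta>"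
proof -
  assume ch: "chord p q \<alpha> \<beta>"
  then have "p + 0 *\<^sub>R (q - p) \<in> C" "p + 1 *\<^sub>R (q - p) \<in> C" by (simp_all add: chord_def)
  then show ?thesis using ch unfolding chord_def by meson
qed

text \<open>The parameters of points in C form an open set because C is open, an interval because C
  is convex, and a bounded set because \<open>c\<close> is constantly 1 on the line and controls the
  norm on C. Hence they fill the open interval from \<open>Inf T\<close> to
  \<open>Sup T\<close>.\<close>

lemma chord_exists:
  assumes "p \<in> C" "q \<in> C" "c \<bullet> p = 1" "c \<bullet> q = 1" "p \<noteq> q"
  obtains \<alpha> \<beta> where "chord p q \<alpha> \<beta>"
proof -
  define z where "z \<tau> = p + \<tau> *\<^sub>R (q - p)" for \<tau> :: real
  define T where "T = {\<tau>. z \<tau> \<in> C}"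
  have "open T"
    unfolding T_def z_def vimage_def[symmetric]
    by (rule open_vimage[OF cone_open]) (intro continuous_intros)
  have conv: "\<tau> \<in> T" if "a \<in> T" "b \<in> T" "a < \<tau>" "\<tau> < b" for a b \<tau>
  proof -
    have "((b - \<tau>) / (b - a)) *\<^sub>R z a + ((\<tau> - a) / (b - a)) *\<^sub>R z b \<in> C"
      using that by (intro cone_add cone_scale) (auto simp: T_def)
    also have "((b - \<tau>) / (b - a)) *\<^sub>R z a + ((\<tau> - a) / (b - a)) *\<^sub>R z b
        = ((b - \<tau>) / (b - a) + (\<tau> - a) / (b - a)) *\<^sub>R p
          + ((b - \<tau>) / (b - a) * a + (\<tau> - a) / (b - a) * b) *\<^sub>R (q - p)"
      by (simp add: z_def algebra_simps)
    also have "(b - \<tau>) / (b - a) + (\<tau> - a) / (b - a) = 1"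
      using that by (simp add: add_divide_distrib[symmetric])
    also have "(b - \<tau>) / (b - a) * a + (\<tau> - a) / (b - a) * b = \<tau>"
      using that by (simp add: divide_simps) (simp add: algebra_simps)
    finally show ?thesis by (simp add: T_def z_def)
  qed
  obtain B where B: "\<And>v. v \<in> closure C \<Longrightarrow> norm v \<le> B * (c \<bullet> v)"
    using cone_norm_bound by metis
  have "\<bar>\<tau>\<bar> \<le> (B + norm p) / norm (q - p)" if "\<tau> \<in> T" for \<tau>
  proof -
    have "z \<tau> \<in> C" using that by (simp add: T_def)
    then have "norm (z \<tau>) \<le> B * (c \<bullet> z \<tau>)" using B closure_subset by blast
    also have "c \<bullet> z \<tau> = 1" using assms by (simp add: z_def inner_diff_right inner_add_right)
    finally have "norm (z \<tau> - p) \<le> B + norm p" by (smt (verit) norm_triangle_ineq4)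
    then have "\<bar>\<tau>\<bar> * norm (q - p) \<le> B + norm p" by (simp add: z_def)
    then show ?thesis using assms(5) by (simp add: field_simps)
  qed
  then have "bounded T" by (auto intro!: boundedI)
  then have bdd: "bdd_above T" "bdd_below T"
    by (rule bounded_imp_bdd_above, rule bounded_imp_bdd_below)
  have ne: "T \<noteq> {}" using assms(1) by (auto simp: T_def z_def intro!: exI[of _ 0])
  have "\<tau> \<in> T \<longleftrightarrow> Inf T < \<tau> \<and> \<tau> < Sup T" for \<tau>
  proof
    assume \<tau>: "\<tau> \<in> T"
    obtain e where e: "0 < e" "cball \<tau> e \<subseteq> T" using \<open>open T\<close> \<tau> by (meson open_contains_cball)
    then have "\<tau> - e \<in> T" "\<tau> + e \<in> T" by (auto simp: dist_real_def subset_iff)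
    then have "Inf T \<le> \<tau> - e" "\<tau> + e \<le> Sup T" using bdd by (auto intro: cInf_lower cSup_upper)
    then show "Inf T < \<tau> \<and> \<tau> < Sup T" using e(1) by auto
  next
    assume "Inf T < \<tau> \<and> \<tau> < Sup T"
    then obtain a b where "a \<in> T" "a < \<tau>" "b \<in> T" "\<tau> < b"
      using cInf_lessD[OF ne] less_cSupD[OF ne] by blast
    then show "\<tau> \<in> T" using conv by blast
  qed
  moreover have "\<tau> \<in> T \<longleftrightarrow> p + \<tau> *\<^sub>R (q - p) \<in> C" for \<tau> by (simp add: T_def z_def)
  ultimately have "chord p q (Inf T) (Sup T)" unfolding chord_def using assms by blast
  then show thesis by (rule that)
qed

lemma chord_endpoints:
  assumes "chord p q \<alpha> \<beta>" "z = (\<lambda>\<tau>. p + \<tau> *\<^sub>R (q - p))"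
  shows "z \<tau> \<in> closure C \<longleftrightarrow> \<alpha> \<le> \<tau> \<and> \<tau> \<le> \<beta>"
proof
  note b = chord_bounds[OF assms(1)]
  have C: "z \<sigma> \<in> C \<longleftrightarrow> \<alpha> < \<sigma> \<and> \<sigma> < \<beta>" for \<sigma>
    using assms by (simp add: chord_def)
  assume \<tau>: "z \<tau> \<in> closure C"
  have p: "p \<in> C" using assms(1) by (simp add: chord_def)
  \<comment> \<open>Moving from a closure point towards \<open>p\<close> enters the open cone at
    once. If \<tau> lay beyond an endpoint, the factor \<alpha>/\<tau> or \<beta>/\<tau> would put
    that endpoint in C.\<close>
  have seg: "z (k * \<tau>) \<in> C" if "0 \<le> k" "k < 1" for k
    using cone_closure_segment[OF p \<tau>, of "1 - k" k] that by (simp add: assms(2) algebra_simps)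
  show "\<alpha> \<le> \<tau> \<and> \<tau> \<le> \<beta>"
  proof (rule ccontr)
    assume "\<not> ?thesis"
    then consider "\<tau> < \<alpha>" | "\<beta> < \<tau>" by linarith
    then show False
    proof cases
      case 1 then show False using seg[of "\<alpha> / \<tau>"] b C[of \<alpha>] by (simp add: field_simps)
    next
      case 2 then show False using seg[of "\<beta> / \<tau>"] b C[of \<beta>] by (simp add: field_simps)
    qed
  qed
next
  note b = chord_bounds[OF assms(1)]
  have C: "z \<sigma> \<in> C \<longleftrightarrow> \<alpha> < \<sigma> \<and> \<sigma> < \<beta>" for \<sigma>
    using assms by (simp add: chord_def)
  assume \<tau>: "\<alpha> \<le> \<tau> \<and> \<tau> \<le> \<beta>"
  then have "\<tau> \<in> closure {\<alpha><..<\<beta>}" using b by simp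
  moreover have "z ` closure {\<alpha><..<\<beta>} \<subseteq> closure C"
  proof (rule image_closure_subset)
    show "continuous_on (closure {\<alpha><..<\<beta>}) z" unfolding assms(2) by (intro continuous_intros)
    show "z ` {\<alpha><..<\<beta>} \<subseteq> closure C"
      using C closure_subset[of C] by (auto simp del: closure_greaterThanLessThan)
  qed simp
  ultimately show "z \<tau> \<in> closure C" by blast
qed

text \<open>This gives the definite description in \<open>hilbert_dist\<close> its pair of boundary
  points: the projective line meets the frontier exactly at the ends of the chord.\<close>

lemma line_inter_frontier:
  assumes "chord p q \<alpha> \<beta>" "z = (\<lambda>\<tau>. p + \<tau> *\<^sub>R (q - p))"
  shows "projective_line (span {p}) (span {q}) \<inter> projective_topology frontier_of \<Omega>
           = {span {z \<alpha>}, span {z \<beta>}}"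
proof -
  note b = chord_bounds[OF assms(1)]
  have ch: "c \<bullet> p = 1" "c \<bullet> q = 1" "p \<noteq> q" using assms(1) by (auto simp: chord_def)
  have C: "z \<sigma> \<in> C \<longleftrightarrow> \<alpha> < \<sigma> \<and> \<sigma> < \<beta>" for \<sigma>
    using assms by (simp add: chord_def)
  have cz: "c \<bullet> z \<tau> = 1" for \<tau> using ch by (simp add: assms(2) inner_diff_right inner_add_right)
  then have z0: "z \<tau> \<noteq> 0" for \<tau> by (metis inner_zero_right zero_neq_one)
  have frontier: "projective_topology frontier_of \<Omega> = projective_topology closure_of \<Omega> - \<Omega>"
    using domain_openin by (simp add: frontier_of_def interior_of_openin)
  obtain B where B: "0 < B" "\<And>v. v \<in> closure C \<Longrightarrow> norm v \<le> B * (c \<bullet> v)"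
    using cone_norm_bound by metis
  have span_pq: "span (span {p} \<union> span {q}) = span {p, q}"
  proof (intro equalityI span_minimal subspace_span)
    show "span {p} \<union> span {q} \<subseteq> span {p, q}" by (simp add: span_mono)
    show "{p, q} \<subseteq> span (span {p} \<union> span {q})" by (simp add: span_base)
  qed
  show ?thesis
  proof (intro equalityI subsetI)
    fix l assume l: "l \<in> projective_line (span {p}) (span {q}) \<inter> projective_topology frontier_of \<Omega>"
    then obtain v where v: "v \<noteq> 0" "l = span {v}" by (auto simp: projective_line_def elim: projective_spaceE)
    have cl: "v \<in> closure C \<or> - v \<in> closure C"
      using l v by (intro closure_of_domainD) (auto simp: frontier)
    \<comment> \<open>The norm bound keeps the line off the hyperplane at infinity, so it has a
      representative on the chord's affine line.\<close>
    have cv: "c \<bullet> v \<noteq> 0"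
      using cl B(2)[of v] B(2)[of "- v"] v(1) by auto
    have "v \<in> span {p, q}"
      using l v span_base[of v "{v}"] by (auto simp: projective_line_def span_pq)
    then obtain k where "v - k *\<^sub>R p \<in> span {q}" by (auto simp: span_breakdown_eq)
    then obtain m where "v - k *\<^sub>R p = m *\<^sub>R q" by (auto simp: span_singleton)
    then have km: "v = k *\<^sub>R p + m *\<^sub>R q" by (simp add: diff_eq_eq add.commute)
    have ckm: "c \<bullet> v = k + m" by (simp add: km ch inner_add_right)
    \<comment> \<open>Chosen so that k p + m q = (k + m) (p + \<tau> (q - p)).\<close>
    define \<tau> where "\<tau> = m / (k + m)"
    have \<tau>: "(k + m) * \<tau> = m" using cv ckm by (simp add: \<tau>_def)
    have "(k + m) *\<^sub>R z \<tau> = (k + m) *\<^sub>R p + ((k + m) * \<tau>) *\<^sub>R (q - p)"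
      by (simp add: assms(2) scaleR_add_right)
    also have "\<dots> = v" unfolding \<tau> by (simp add: km algebra_simps)
    finally have vz: "v = (k + m) *\<^sub>R z \<tau>" by simp
    have lz: "l = span {z \<tau>}" using v vz cv ckm by (simp add: span_scaleR)
    have cl': "z \<tau> \<in> closure C"
    proof -
      have "z \<tau> \<in> closure C \<or> - z \<tau> \<in> closure C"
        using closure_of_domainD[OF z0] l lz by (auto simp: frontier)
      moreover have "- z \<tau> \<notin> closure C" using B(1) B(2)[of "- z \<tau>"] cz[of \<tau>]
        by (smt (verit) inner_minus_right mult_minus_right mult_cancel_left1 norm_ge_zero)
      ultimately show ?thesis by blast
    qed
    have "z \<tau> \<notin> C" using l lz cone_span by (auto simp: frontier)
    then have "\<tau> = \<alpha> \<or> \<tau> = \<beta>" using cl' chord_endpoints[OF assms, of \<tau>] C by force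
    then show "l \<in> {span {z \<alpha>}, span {z \<beta>}}" using lz by blast
  next
    fix l assume "l \<in> {span {z \<alpha>}, span {z \<beta>}}"
    then obtain \<tau> where \<tau>: "l = span {z \<tau>}" "\<tau> = \<alpha> \<or> \<tau> = \<beta>" by blast
    have "z \<tau> \<in> closure C" using chord_endpoints[OF assms, of \<tau>] b \<tau> by auto
    then have "l \<in> projective_topology closure_of \<Omega>" using closure_of_domainI z0 \<tau> by blast
    moreover have "l \<notin> \<Omega>"
      using C[of \<tau>] \<tau> cone_pos[of "- z \<tau>"] cz[of \<tau>] span_in_domain_iff[of "z \<tau>"] by auto
    moreover have "z \<tau> \<in> span {p, q}"
      unfolding assms(2) by (intro span_add span_scale span_diff span_base) auto
    then have "l \<in> projective_line (span {p}) (span {q})"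
      using span_in_projective_space[OF z0] \<tau> span_minimal[of "{z \<tau>}" "span {p, q}"]
      by (simp add: projective_line_def span_pq)
    ultimately show "l \<in> projective_line (span {p}) (span {q}) \<inter> projective_topology frontier_of \<Omega>"
      by (simp add: frontier)
  qed
qed

lemma hilbert_dist_chord:
  assumes "chord p q \<alpha> \<beta>"
  shows "hilbert_dist c \<Omega> (span {p}) (span {q})
           = 1 / 2 * ln ((1 - \<alpha>) * \<beta> / (- \<alpha> * (\<beta> - 1)))"
proof -
  define z where "z \<tau> = p + \<tau> *\<^sub>R (q - p)" for \<tau> :: real
  have z': "z = (\<lambda>\<tau>. p + \<tau> *\<^sub>R (q - p))" by (simp add: z_def fun_eq_iff)
  note b = chord_bounds[OF assms]
  have ch: "c \<bullet> p = 1" "c \<bullet> q = 1" "p \<noteq> q" using assms by (auto simp: chord_def)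
  have coord: "chart_coord c (span {v}) = v" if "c \<bullet> v = 1" for v
    using that by (simp add: chart_coord_span)
  have cz: "c \<bullet> z \<tau> = 1" for \<tau> using ch by (simp add: z_def inner_diff_right inner_add_right)
  have dz: "dist (z \<tau>) p = \<bar>\<tau>\<bar> * norm (q - p)" "dist (z \<tau>) q = \<bar>\<tau> - 1\<bar> * norm (q - p)"
    "dist p (z \<tau>) = \<bar>\<tau>\<bar> * norm (q - p)" "dist q (z \<tau>) = \<bar>\<tau> - 1\<bar> * norm (q - p)" for \<tau>
  proof -
    have "z \<tau> - p = \<tau> *\<^sub>R (q - p)" "z \<tau> - q = (\<tau> - 1) *\<^sub>R (q - p)"
      by (simp_all add: z_def algebra_simps)
    then show "dist (z \<tau>) p = \<bar>\<tau>\<bar> * norm (q - p)" "dist (z \<tau>) q = \<bar>\<tau> - 1\<bar> * norm (q - p)"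
      by (simp_all only: dist_norm norm_scaleR)
    then show "dist p (z \<tau>) = \<bar>\<tau>\<bar> * norm (q - p)" "dist q (z \<tau>) = \<bar>\<tau> - 1\<bar> * norm (q - p)"
      by (simp_all only: dist_commute)
  qed
  \<comment> \<open>The cross ratio in parameters: each chart distance is a parameter difference
    times \<open>norm (q - p)\<close>, which cancels. As r > 1, both orders of the endpoints give
    the same absolute logarithm ln r.\<close>
  define r where "r = (1 - \<alpha>) * \<beta> / (- \<alpha> * (\<beta> - 1))"
  have "- \<alpha> * (\<beta> - 1) < (1 - \<alpha>) * \<beta>" using b by (simp add: algebra_simps)
  moreover have "0 < - \<alpha> * (\<beta> - 1)" using b by (intro mult_pos_pos) auto
  ultimately have r: "1 < r" unfolding r_def by (subst less_divide_eq_1_pos)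
  have n0: "norm (q - p) \<noteq> 0" using ch by simp
  have frac: "(a * norm (q - p) * (a' * norm (q - p))) / (b * norm (q - p) * (b' * norm (q - p)))
      = (a * a') / (b * b')" for a a' b b'
    using n0 by simp
  have abs: "\<bar>\<alpha>\<bar> = - \<alpha>" "\<bar>\<alpha> - 1\<bar> = 1 - \<alpha>" "\<bar>\<beta>\<bar> = \<beta>" "\<bar>\<beta> - 1\<bar> = \<beta> - 1"
    using b by auto
  have cr: "cross_ratio c (span {z \<alpha>}) (span {p}) (span {q}) (span {z \<beta>}) = r"
    "cross_ratio c (span {z \<beta>}) (span {p}) (span {q}) (span {z \<alpha>}) = 1 / r"
    unfolding cross_ratio_def coord[OF cz] coord[OF ch(1)] coord[OF ch(2)] dz abs frac r_def
    by (simp_all add: ac_simps)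
  have neq: "span {z \<alpha>} \<noteq> span {z \<beta>}"
  proof
    assume "span {z \<alpha>} = span {z \<beta>}"
    then have "z \<alpha> = z \<beta>" using coord cz by metis
    then show False using b ch by (simp add: z_def)
  qed
  have pq: "span {p} \<noteq> span {q}" using coord ch by metis
  have line: "projective_line (span {p}) (span {q}) \<inter> projective_topology frontier_of \<Omega>
      = {span {z \<alpha>}, span {z \<beta>}}"
    by (rule line_inter_frontier[OF assms z'])
  have "hilbert_dist c \<Omega> (span {p}) (span {q}) = (THE d. d = 1 / 2 * ln r)"
    unfolding hilbert_dist_def line if_not_P[OF pq]
  proof (rule arg_cong[where f = The], rule ext)
    fix d
    have l: "\<bar>ln (1 / r)\<bar> = ln r" "\<bar>ln r\<bar> = ln r" using r by (simp_all add: ln_div)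
    show "(\<exists>a b. a \<noteq> b \<and> {span {z \<alpha>}, span {z \<beta>}} = {a, b} \<and>
        d = 1 / 2 * \<bar>ln (cross_ratio c a (span {p}) (span {q}) b)\<bar>) = (d = 1 / 2 * ln r)"
    proof
      assume "d = 1 / 2 * ln r"
      then show "\<exists>a b. a \<noteq> b \<and> {span {z \<alpha>}, span {z \<beta>}} = {a, b} \<and>
          d = 1 / 2 * \<bar>ln (cross_ratio c a (span {p}) (span {q}) b)\<bar>"
        using neq cr l by metis
    next
      assume "\<exists>a b. a \<noteq> b \<and> {span {z \<alpha>}, span {z \<beta>}} = {a, b} \<and>
          d = 1 / 2 * \<bar>ln (cross_ratio c a (span {p}) (span {q}) b)\<bar>"
      then show "d = 1 / 2 * ln r" using cr l by (metis doubleton_eq_iff)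
    qed
  qed
  also have "\<dots> = 1 / 2 * ln r" by (rule the_eq_trivial)
  finally show ?thesis by (simp only: r_def)
qed

lemma cone_close_chord:
  assumes "chord p q \<alpha> \<beta>"
  shows "cone_close p q R \<longleftrightarrow> 1 / 2 * ln ((1 - \<alpha>) * \<beta> / (- \<alpha> * (\<beta> - 1))) < R"
proof -
  note b = chord_bounds[OF assms]
  have ch: "c \<bullet> p = 1" "c \<bullet> q = 1" using assms by (auto simp: chord_def)
  have C: "p + \<tau> *\<^sub>R (q - p) \<in> C \<longleftrightarrow> \<alpha> < \<tau> \<and> \<tau> < \<beta>" for \<tau>
    using assms by (simp add: chord_def)
  \<comment> \<open>For t < 1, p - t q is (1 - t) times the chord point of parameter -t / (1 - t),
    and q - s p with s < 1 is (1 - s) times the one of parameter 1 / (1 - s). \<open>T\<close> and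
    \<open>S\<close> are the values of t and s at which these parameters reach \<alpha> and \<beta>;
    1 / (T S) is the cross ratio.\<close>
  define T where "T = - \<alpha> / (1 - \<alpha>)"
  define S where "S = (\<beta> - 1) / \<beta>"
  have TS: "0 < T" "T < 1" "0 < S" "S < 1" using b by (simp_all add: T_def S_def field_simps)
  have t: "p - t *\<^sub>R q \<in> C \<longleftrightarrow> t < T" if "0 < t" for t
  proof (cases "t < 1")
    case True
    have "(1 - t) * (- t / (1 - t)) = - t" using True by simp
    then have "p - t *\<^sub>R q = (1 - t) *\<^sub>R p + ((1 - t) * (- t / (1 - t))) *\<^sub>R (q - p)"
      by (simp only:) (simp add: algebra_simps)
    also have "\<dots> = (1 - t) *\<^sub>R (p + (- t / (1 - t)) *\<^sub>R (q - p))"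
      by (simp only: scaleR_add_right scaleR_scaleR)
    finally have eq: "p - t *\<^sub>R q = (1 - t) *\<^sub>R (p + (- t / (1 - t)) *\<^sub>R (q - p))" .
    have "p - t *\<^sub>R q \<in> C \<longleftrightarrow> p + (- t / (1 - t)) *\<^sub>R (q - p) \<in> C"
      unfolding eq using True by (intro cone_scale_iff) simp
    also have "\<dots> \<longleftrightarrow> \<alpha> < - t / (1 - t) \<and> - t / (1 - t) < \<beta>" by (rule C)
    also have "- t / (1 - t) < \<beta>" using True that b by (smt (verit) divide_neg_pos)
    then have "(\<alpha> < - t / (1 - t) \<and> - t / (1 - t) < \<beta>) \<longleftrightarrow> t < T"
      using True b by (simp add: T_def field_simps)
    finally show ?thesis .
  next
    case False
    then have "\<not> 0 < c \<bullet> (p - t *\<^sub>R q)" using ch by (simp add: inner_diff_right)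
    then show ?thesis using cone_pos TS False by force
  qed
  have s: "q - s *\<^sub>R p \<in> C \<longleftrightarrow> s < S" if "0 < s" for s
  proof (cases "s < 1")
    case True
    have "(1 - s) * (1 / (1 - s)) = 1" using True by simp
    then have "q - s *\<^sub>R p = (1 - s) *\<^sub>R p + ((1 - s) * (1 / (1 - s))) *\<^sub>R (q - p)"
      by (simp only:) (simp add: algebra_simps)
    also have "\<dots> = (1 - s) *\<^sub>R (p + (1 / (1 - s)) *\<^sub>R (q - p))"
      by (simp only: scaleR_add_right scaleR_scaleR)
    finally have eq: "q - s *\<^sub>R p = (1 - s) *\<^sub>R (p + (1 / (1 - s)) *\<^sub>R (q - p))" .
    have "q - s *\<^sub>R p \<in> C \<longleftrightarrow> p + (1 / (1 - s)) *\<^sub>R (q - p) \<in> C"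
      unfolding eq using True by (intro cone_scale_iff) simp
    also have "\<dots> \<longleftrightarrow> \<alpha> < 1 / (1 - s) \<and> 1 / (1 - s) < \<beta>" by (rule C)
    also have "\<alpha> < 1 / (1 - s)" using True b by (smt (verit) divide_pos_pos)
    then have "(\<alpha> < 1 / (1 - s) \<and> 1 / (1 - s) < \<beta>) \<longleftrightarrow> s < S"
      using True b by (simp add: S_def field_simps)
    finally show ?thesis .
  next
    case False
    then have "\<not> 0 < c \<bullet> (q - s *\<^sub>R p)" using ch by (simp add: inner_diff_right)
    then show ?thesis using cone_pos TS False by force
  qed
  have "cone_close p q R \<longleftrightarrow> (\<exists>t>0. \<exists>s>0. t < T \<and> s < S \<and> exp (- 2 * R) < t * s)"
    unfolding cone_close_def using t s by blast
  also have "\<dots> \<longleftrightarrow> exp (- 2 * R) < T * S"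
  proof
    assume "\<exists>t>0. \<exists>s>0. t < T \<and> s < S \<and> exp (- 2 * R) < t * s"
    then obtain t s where "0 < t" "0 < s" "t < T" "s < S" "exp (- 2 * R) < t * s" by blast
    moreover have "t * s < T * S" using calculation by (intro mult_strict_mono) auto
    ultimately show "exp (- 2 * R) < T * S" by linarith
  next
    assume less: "exp (- 2 * R) < T * S"
    \<comment> \<open>\<open>T\<close> and \<open>S\<close> are not themselves admissible, so both
      are shrunk by a common factor k < 1 close to 1.\<close>
    have "((\<lambda>k. (k * T) * (k * S)) \<longlongrightarrow> (1 * T) * (1 * S)) (at_left 1)"
      by (intro tendsto_intros)
    then have "eventually (\<lambda>k. exp (- 2 * R) < (k * T) * (k * S)) (at_left 1)"
      by (rule order_tendstoD(1)) (use less in simp)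
    moreover have "eventually (\<lambda>k::real. k \<in> {0<..<1}) (at_left 1)"
      by (rule eventually_at_left_real) simp
    ultimately have "eventually (\<lambda>k. 0 < k \<and> k < 1 \<and> exp (- 2 * R) < (k * T) * (k * S)) (at_left 1)"
      by eventually_elim simp
    then obtain k where "0 < k" "k < 1" "exp (- 2 * R) < (k * T) * (k * S)"
      using eventually_happens trivial_limit_at_left_real by blast
    then show "\<exists>t>0. \<exists>s>0. t < T \<and> s < S \<and> exp (- 2 * R) < t * s"
      using TS by (intro exI[of _ "k * T"] conjI exI[of _ "k * S"]) auto
  qed
  also have "\<dots> \<longleftrightarrow> 1 / (T * S) < exp (2 * R)"
    using TS by (simp add: exp_minus field_simps)
  also have "\<dots> \<longleftrightarrow> ln (1 / (T * S)) < 2 * R"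
    using TS by (metis exp_less_cancel_iff exp_ln mult_pos_pos zero_less_divide_1_iff)
  also have "1 / (T * S) = (1 - \<alpha>) * \<beta> / (- \<alpha> * (\<beta> - 1))"
    using b by (simp add: T_def S_def)
  finally show ?thesis by (simp add: mult.commute)
qed

lemma hilbert_dist_less_iff:
  assumes "u \<in> C" "v \<in> C"
  shows "hilbert_dist c \<Omega> (span {u}) (span {v}) < R \<longleftrightarrow> cone_close u v R"
proof -
  let ?p = "(1 / (c \<bullet> u)) *\<^sub>R u" and ?q = "(1 / (c \<bullet> v)) *\<^sub>R v"
  note pos = cone_pos[OF assms(1)] cone_pos[OF assms(2)]
  have sp: "span {?p} = span {u}" "span {?q} = span {v}" using pos by (simp_all add: span_scaleR)
  have pq: "?p \<in> C" "?q \<in> C" "c \<bullet> ?p = 1" "c \<bullet> ?q = 1" using assms cone_scale pos by simp_all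
  have sc: "cone_close u v R \<longleftrightarrow> cone_close ?p ?q R" using pos by (simp add: cone_close_scale)
  show ?thesis
  proof (cases "?p = ?q")
    case True
    then have "hilbert_dist c \<Omega> (span {u}) (span {v}) = 0" using sp by (simp add: hilbert_dist_def)
    moreover have "cone_close ?p ?q R \<longleftrightarrow> 0 < R"
      using True cone_close_refl cone_close_pos pq by metis
    ultimately show ?thesis using sc by simp
  next
    case False
    then obtain \<alpha> \<beta> where "chord ?p ?q \<alpha> \<beta>" using pq by (auto elim: chord_exists)
    then show ?thesis using hilbert_dist_chord cone_close_chord sp sc by metis
  qed
qed


subsection \<open>Metric properties\<close>

abbreviation "d \<equiv> hilbert_dist c \<Omega>"

lemma hilbert_dist_triangle:
  assumes "x \<in> \<Omega>" "y \<in> \<Omega>" "z \<in> \<Omega>"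
  shows "d x z \<le> d x y + d y z"
proof (rule field_le_epsilon)
  fix e :: real assume e: "0 < e"
  obtain u where u: "u \<in> C" "x = span {u}" by (rule domain_repE[OF assms(1)])
  obtain v where v: "v \<in> C" "y = span {v}" by (rule domain_repE[OF assms(2)])
  obtain w where w: "w \<in> C" "z = span {w}" by (rule domain_repE[OF assms(3)])
  \<comment> \<open>\<open>cone_close\<close> encodes a strict inequality, so each distance needs
    some slack.\<close>
  have "cone_close u v (d x y + e / 2)" "cone_close v w (d y z + e / 2)"
    using e u v w by (auto simp: hilbert_dist_less_iff[symmetric])
  then have "cone_close u w ((d x y + e / 2) + (d y z + e / 2))" by (rule cone_close_trans)
  then have "d x z < (d x y + e / 2) + (d y z + e / 2)"
    using u w by (simp only: hilbert_dist_less_iff)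
  then show "d x z \<le> d x y + d y z + e" by simp
qed

lemma hilbert_dist_sym:
  assumes "x \<in> \<Omega>" "y \<in> \<Omega>"
  shows "d x y = d y x"
proof -
  obtain u where u: "u \<in> C" "x = span {u}" by (rule domain_repE[OF assms(1)])
  obtain v where v: "v \<in> C" "y = span {v}" by (rule domain_repE[OF assms(2)])
  have "d x y < R \<longleftrightarrow> d y x < R" for R
    using u v cone_close_sym by (auto simp: hilbert_dist_less_iff)
  then show ?thesis by (metis less_irrefl linorder_neqE_linordered_idom)
qed

lemma hilbert_dist_nonneg:
  assumes "x \<in> \<Omega>" "y \<in> \<Omega>"
  shows "0 \<le> d x y"
proof -
  obtain u where u: "u \<in> C" "x = span {u}" by (rule domain_repE[OF assms(1)])
  obtain v where v: "v \<in> C" "y = span {v}" by (rule domain_repE[OF assms(2)])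
  have "0 < R" if "d x y < R" for R
    using that u v cone_close_pos by (auto simp: hilbert_dist_less_iff)
  then show ?thesis by (meson less_irrefl not_le)
qed

text \<open>A linear map sending the cone into itself preserves the order relations with the same
  factors t and s, so it cannot increase distance. Isometry of group elements follows by applying
  this to the inverse as well.\<close>

lemma hilbert_dist_matrix_le:
  assumes "\<And>v. v \<in> C \<Longrightarrow> A *v v \<in> C" "u \<in> C" "v \<in> C"
  shows "d (span {A *v u}) (span {A *v v}) \<le> d (span {u}) (span {v})"
proof (rule dense_ge)
  fix R assume "d (span {u}) (span {v}) < R"
  then obtain t s where ts: "0 < t" "0 < s" "u - t *\<^sub>R v \<in> C" "v - s *\<^sub>R u \<in> C" "exp (- 2 * R) < t * s"
    using assms by (auto simp: hilbert_dist_less_iff cone_close_def)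
  have "A *v u - t *\<^sub>R (A *v v) \<in> C" "A *v v - s *\<^sub>R (A *v u) \<in> C"
    using assms(1)[OF ts(3)] assms(1)[OF ts(4)]
    by (simp_all add: matrix_vector_mult_diff_distrib matrix_vector_mult_scaleR)
  then have "cone_close (A *v u) (A *v v) R" unfolding cone_close_def using ts by blast
  then show "d (span {A *v u}) (span {A *v v}) \<le> R"
    using hilbert_dist_less_iff[of "A *v u" "A *v v" R] assms by simp
qed

section \<open>Distances along a chord and geodesic segments\<close>

lemma hilbert_dist_on_chord:
  assumes ch: "chord p q \<alpha> \<beta>" and z: "z = (\<lambda>\<tau>. p + \<tau> *\<^sub>R (q - p))"
    and less: "\<alpha> < \<tau>" "\<tau> < \<sigma>" "\<sigma> < \<beta>"
  shows "d (span {z \<tau>}) (span {z \<sigma>}) = 1 / 2 * ln ((\<sigma> - \<alpha>) * (\<beta> - \<tau>) / ((\<tau> - \<alpha>) * (\<beta> - \<sigma>)))"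
proof -
  let ?h = "\<sigma> - \<tau>"
  \<comment> \<open>The same line reparametrised with z \<tau> at 0 and z \<sigma> at 1.\<close>
  define \<alpha>' where "\<alpha>' = (\<alpha> - \<tau>) / ?h"
  define \<beta>' where "\<beta>' = (\<beta> - \<tau>) / ?h"
  have zz: "z \<sigma> - z \<tau> = ?h *\<^sub>R (q - p)" by (simp add: z algebra_simps)
  have pq: "c \<bullet> p = 1" "c \<bullet> q = 1" "p \<noteq> q" using ch by (auto simp: chord_def)
  have C: "z \<rho> \<in> C \<longleftrightarrow> \<alpha> < \<rho> \<and> \<rho> < \<beta>" for \<rho> using ch by (simp add: chord_def z)
  have "chord (z \<tau>) (z \<sigma>) \<alpha>' \<beta>'"
    unfolding chord_def
  proof (intro conjI allI)
    show "c \<bullet> z \<tau> = 1" "c \<bullet> z \<sigma> = 1" by (simp_all add: z pq inner_diff_right inner_add_right)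
    show "z \<tau> \<noteq> z \<sigma>" using zz less pq by auto
    show "z \<tau> \<in> C" "z \<sigma> \<in> C" using C less by auto
    fix \<rho>
    have "z \<tau> + \<rho> *\<^sub>R (z \<sigma> - z \<tau>) = z (\<tau> + \<rho> * ?h)" unfolding zz by (simp add: z algebra_simps)
    then have "z \<tau> + \<rho> *\<^sub>R (z \<sigma> - z \<tau>) \<in> C \<longleftrightarrow> \<alpha> < \<tau> + \<rho> * ?h \<and> \<tau> + \<rho> * ?h < \<beta>"
      by (simp only: C)
    also have "\<dots> \<longleftrightarrow> \<alpha>' < \<rho> \<and> \<rho> < \<beta>'"
      unfolding \<alpha>'_def \<beta>'_def using less
      by (subst pos_divide_less_eq, simp, subst pos_less_divide_eq, simp) auto
    finally show "z \<tau> + \<rho> *\<^sub>R (z \<sigma> - z \<tau>) \<in> C \<longleftrightarrow> \<alpha>' < \<rho> \<and> \<rho> < \<beta>'" .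
  qed
  then have "d (span {z \<tau>}) (span {z \<sigma>}) = 1 / 2 * ln ((1 - \<alpha>') * \<beta>' / (- \<alpha>' * (\<beta>' - 1)))"
    by (rule hilbert_dist_chord)
  also have "(1 - \<alpha>') * \<beta>' / (- \<alpha>' * (\<beta>' - 1))
      = (\<sigma> - \<alpha>) * (\<beta> - \<tau>) / ((\<tau> - \<alpha>) * (\<beta> - \<sigma>))"
  proof -
    have "1 - \<alpha>' = (\<sigma> - \<alpha>) / ?h" "- \<alpha>' = (\<tau> - \<alpha>) / ?h" "\<beta>' - 1 = (\<beta> - \<sigma>) / ?h"
      using less by (simp_all add: \<alpha>'_def \<beta>'_def field_simps)
    then show ?thesis using less by (simp only:) (simp add: \<beta>'_def)
  qed
  finally show ?thesis .
qed

lemma chord_point_at_distance: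
  assumes ch: "chord p q \<alpha> \<beta>" and R: "0 < R"
  obtains r where "span {r} \<in> \<Omega>" "d (span {p}) (span {r}) = R"
    "R < d (span {p}) (span {q}) \<Longrightarrow> d (span {r}) (span {q}) = d (span {p}) (span {q}) - R"
proof -
  define z where "z = (\<lambda>\<tau>. p + \<tau> *\<^sub>R (q - p))"
  note b = chord_bounds[OF ch]
  have C: "z \<rho> \<in> C \<longleftrightarrow> \<alpha> < \<rho> \<and> \<rho> < \<beta>" for \<rho> using ch by (simp add: chord_def z_def)
  have z01: "z 0 = p" "z 1 = q" by (simp_all add: z_def)
  \<comment> \<open>The distance formula from parameter 0 to \<tau> equals R exactly when (\<tau> -
    \<alpha>) / (\<beta> - \<tau>) is this \<open>k\<close>; \<tau> below divides the chord in that
    ratio.\<close>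
  define k where "k = exp (2 * R) * (- \<alpha>) / \<beta>"
  define \<tau> where "\<tau> = (k * \<beta> + \<alpha>) / (1 + k)"
  have k: "0 < k" unfolding k_def using b by (intro divide_pos_pos mult_pos_pos) auto
  have kb: "k * \<beta> = exp (2 * R) * (- \<alpha>)" using b by (simp add: k_def)
  have \<tau>: "\<tau> - \<alpha> = k * ((\<beta> - \<alpha>) / (1 + k))" "\<beta> - \<tau> = (\<beta> - \<alpha>) / (1 + k)"
    using k by (simp_all add: \<tau>_def field_simps)
  have h: "0 < (\<beta> - \<alpha>) / (1 + k)" using k b by simp
  have "1 * (- \<alpha>) < exp (2 * R) * (- \<alpha>)" using R b by (intro mult_strict_right_mono) auto
  then have \<tau>0: "0 < \<tau>" using kb k by (simp add: \<tau>_def)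
  have \<tau>b: "\<tau> < \<beta>" using \<tau>(2) h by simp
  have "d (span {z 0}) (span {z \<tau>}) = 1 / 2 * ln ((\<tau> - \<alpha>) * (\<beta> - 0) / ((0 - \<alpha>) * (\<beta> - \<tau>)))"
    by (rule hilbert_dist_on_chord[OF ch z_def]) (use b \<tau>0 \<tau>b in auto)
  also have "(\<tau> - \<alpha>) * (\<beta> - 0) / ((0 - \<alpha>) * (\<beta> - \<tau>)) = exp (2 * R)"
  proof -
    have kH: "k * H * (\<beta> - 0) = exp (2 * R) * ((0 - \<alpha>) * H)" for H
    proof -
      have "k * H * (\<beta> - 0) = (k * \<beta>) * H" by simp
      also have "\<dots> = exp (2 * R) * ((0 - \<alpha>) * H)" unfolding kb by simp
      finally show ?thesis .
    qed
    have "(\<tau> - \<alpha>) * (\<beta> - 0) = exp (2 * R) * ((0 - \<alpha>) * (\<beta> - \<tau>))"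
      unfolding \<tau> by (rule kH)
    moreover have "(0 - \<alpha>) * (\<beta> - \<tau>) \<noteq> 0" using b \<tau>b by simp
    ultimately show ?thesis by (subst nonzero_divide_eq_eq)
  qed
  finally have dR: "d (span {p}) (span {z \<tau>}) = R" by (simp add: z01)
  have D: "d (span {p}) (span {q}) = 1 / 2 * ln ((1 - \<alpha>) * \<beta> / (- \<alpha> * (\<beta> - 1)))"
    by (rule hilbert_dist_chord[OF ch])
  define r where "r = (1 - \<alpha>) * \<beta> / (- \<alpha> * (\<beta> - 1))"
  have r: "0 < r" unfolding r_def using b by (intro divide_pos_pos mult_pos_pos) auto
  have "d (span {z \<tau>}) (span {q}) = d (span {p}) (span {q}) - R" if "R < d (span {p}) (span {q})"
  proof -
    have "2 * R < ln r" using that by (simp add: D r_def)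
    then have "exp (2 * R) < r" using r by (metis exp_less_cancel_iff exp_ln)
    then have "exp (2 * R) * (- \<alpha> * (\<beta> - 1)) < (1 - \<alpha>) * \<beta>"
      unfolding r_def by (subst (asm) pos_less_divide_eq) (use b in \<open>auto intro!: mult_pos_pos simp: mult_neg_pos\<close>)
    then have "k * (\<beta> - 1) * \<beta> < (1 - \<alpha>) * \<beta>" using kb by (simp add: algebra_simps)
    then have "k * (\<beta> - 1) < 1 - \<alpha>" using b by simp
    \<comment> \<open>The new point lies before q. Cross ratios along a chord multiply, so the
      remaining one is r / exp (2R) and the distances add.\<close>
    then have \<tau>1: "\<tau> < 1" using k by (simp add: \<tau>_def field_simps)
    have "d (span {z \<tau>}) (span {z 1}) = 1 / 2 * ln ((1 - \<alpha>) * (\<beta> - \<tau>) / ((\<tau> - \<alpha>) * (\<beta> - 1)))"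
      by (rule hilbert_dist_on_chord[OF ch z_def]) (use b \<tau>0 \<tau>1 in auto)
    also have "(1 - \<alpha>) * (\<beta> - \<tau>) / ((\<tau> - \<alpha>) * (\<beta> - 1)) = (1 - \<alpha>) / (k * (\<beta> - 1))"
    proof -
      have "(1 - \<alpha>) * H / (k * H * (\<beta> - 1)) = (1 - \<alpha>) / (k * (\<beta> - 1))" if "0 < H" for H
        using that by simp
      from this[OF h] show ?thesis unfolding \<tau> .
    qed
    also have "\<dots> = r / exp (2 * R)"
    proof -
      have "X / (E * a / b * b') = (X * b / (a * b')) / E" for X E a b b' :: real by simp
      then show ?thesis unfolding k_def r_def .
    qed
    also have "ln (r / exp (2 * R)) = ln r - 2 * R" using r by (simp add: ln_div)
    finally show ?thesis by (simp add: D r_def z01 field_simps)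
  qed
  moreover have "span {z \<tau>} \<in> \<Omega>" using C \<tau>0 \<tau>b b by (intro cone_span) auto
  ultimately show thesis using that dR by blast
qed

lemma hilbert_dist_self [simp]: "d x x = 0"
  by (simp add: hilbert_dist_def)

lemma geodesic_point:
  assumes "x \<in> \<Omega>" "y \<in> \<Omega>" "0 \<le> R" "R \<le> d x y"
  obtains z where "z \<in> \<Omega>" "d x z = R" "d z y = d x y - R"
proof (cases "R = 0 \<or> R = d x y")
  case True
  then show thesis using that[of x] that[of y] assms by auto
next
  case False
  obtain p where p: "p \<in> C" "c \<bullet> p = 1" "x = span {p}" by (rule domain_repE[OF assms(1)])
  obtain q where q: "q \<in> C" "c \<bullet> q = 1" "y = span {q}" by (rule domain_repE[OF assms(2)])
  have "p \<noteq> q" using False assms p q by auto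
  then obtain \<alpha> \<beta> where "chord p q \<alpha> \<beta>" using chord_exists p q by metis
  then obtain r where "span {r} \<in> \<Omega>" "d (span {p}) (span {r}) = R"
    "R < d (span {p}) (span {q}) \<Longrightarrow> d (span {r}) (span {q}) = d (span {p}) (span {q}) - R"
    using chord_point_at_distance[of p q \<alpha> \<beta> R] False assms(3) by auto
  then show thesis using that p q False assms by auto
qed

text \<open>Every chord through x has infinite Hilbert length in both directions. A chord exists
  because some nonzero \<open>e\<close> is orthogonal to \<open>c\<close>, and a small step along it
  stays in C at height 1.\<close>

lemma exists_at_distance:
  assumes "2 \<le> CARD('n)" "x \<in> \<Omega>" "0 < R"
  obtains z where "z \<in> \<Omega>" "d x z = R"
proof -
  obtain p where p: "p \<in> C" "c \<bullet> p = 1" "x = span {p}" by (rule domain_repE[OF assms(2)])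
  obtain e where e: "e \<noteq> 0" "c \<bullet> e = 0"
    using orthogonal_to_vector_exists[of c] assms(1) by (auto simp: orthogonal_def)
  obtain \<epsilon> where \<epsilon>: "0 < \<epsilon>" "cball p \<epsilon> \<subseteq> C" using cone_open p(1) by (meson open_contains_cball)
  define q where "q = p + (\<epsilon> / norm e) *\<^sub>R e"
  have "q \<in> C" using \<epsilon> e by (auto simp: q_def dist_norm intro!: subsetD[OF \<epsilon>(2)])
  moreover have "c \<bullet> q = 1" "p \<noteq> q" using e p \<epsilon> by (auto simp: q_def inner_add_right)
  ultimately obtain \<alpha> \<beta> where "chord p q \<alpha> \<beta>" using chord_exists p by metis
  then show thesis using chord_point_at_distance[OF _ assms(3)] that p by metis
qed

section \<open>Hilbert balls are open and relatively compact\<close>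

lemma ball_openin:
  assumes "x \<in> \<Omega>"
  shows "openin projective_topology {y \<in> \<Omega>. d x y < R}"
proof -
  obtain u where u: "u \<in> C" "x = span {u}" by (rule domain_repE[OF assms])
  define W where "W = {v \<in> C. cone_close u v R}"
  \<comment> \<open>For fixed factors t and s the condition on v is open because C is open; the
    existential quantifiers become a union.\<close>
  have "W = (\<Union>(t, s) \<in> {(t, s). 0 < t \<and> 0 < s \<and> exp (- 2 * R) < t * s}.
      C \<inter> (\<lambda>v. u - t *\<^sub>R v) -` C \<inter> (\<lambda>v. v - s *\<^sub>R u) -` C)"
    unfolding W_def cone_close_def by auto
  also have "open \<dots>"
    by (intro open_UN ballI) (auto intro!: open_Int cone_open open_vimage continuous_intros)
  finally have W: "open W" .
  have in_W: "v \<in> W \<longleftrightarrow> v \<in> C \<and> d x (span {v}) < R" for v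
    using u by (auto simp: W_def hilbert_dist_less_iff)
  have "{v. v \<noteq> 0 \<and> span {v} \<in> {y \<in> \<Omega>. d x y < R}} = W \<union> uminus -` W"
    using cone_nonzero[of 0] span_scaleR[of "-1" "_ :: real^'n"] by (auto simp: in_W span_in_domain_iff)
  moreover have "open (uminus -` W)" using W by (intro open_vimage continuous_intros)
  ultimately show ?thesis
    using W domain_subset by (auto simp: openin_projective_topology)
qed

text \<open>If y is near x, its normalised representative v exceeds \<eta> u in the cone order for a
  fixed \<eta> > 0. So v lies in the contraction of the compact slice \<open>W\<close> towards u by
  the factor 1 - \<eta>, and this contraction stays inside the open cone.\<close>

lemma ball_subset_compact:
  assumes "x \<in> \<Omega>" "0 \<le> R"
  obtains K where "K \<subseteq> \<Omega>" "compactin projective_topology K" "\<And>y. y \<in> \<Omega> \<Longrightarrow> d x y \<le> R \<Longrightarrow> y \<in> K"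
proof -
  obtain u where u: "u \<in> C" "c \<bullet> u = 1" "x = span {u}" by (rule domain_repE[OF assms(1)])
  \<comment> \<open>The \<open>+ 1\<close> turns the closed ball into a strict inequality and also
    gives \<eta> < 1 when R = 0.\<close>
  define \<eta> where "\<eta> = exp (- 2 * (R + 1))"
  have \<eta>: "0 < \<eta>" "\<eta> < 1" using assms(2) by (simp_all add: \<eta>_def)
  obtain B where B: "\<And>v. v \<in> closure C \<Longrightarrow> norm v \<le> B * (c \<bullet> v)" using cone_norm_bound by metis
  define W where "W = closure C \<inter> {w. c \<bullet> w = 1}"
  have "compact W"
    unfolding compact_eq_bounded_closed
  proof
    show "bounded W" by (rule boundedI[of _ B]) (use B in \<open>force simp: W_def\<close>)
    show "closed W" unfolding W_def by (intro closed_Int closed_closure closed_hyperplane)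
  qed
  define V where "V = (\<lambda>w. \<eta> *\<^sub>R u + (1 - \<eta>) *\<^sub>R w) ` W"
  have VC: "V \<subseteq> C" using u \<eta> by (auto simp: V_def W_def intro: cone_closure_segment)
  have "compact V" unfolding V_def by (intro compact_continuous_image \<open>compact W\<close> continuous_intros)
  show thesis
  proof (rule that)
    show "(\<lambda>v. span {v}) ` V \<subseteq> \<Omega>" using VC cone_span by blast
    show "compactin projective_topology ((\<lambda>v. span {v}) ` V)"
      using \<open>compact V\<close> VC cone_nonzero by (intro compactin_span_image) auto
    fix y assume y: "y \<in> \<Omega>" "d x y \<le> R"
    obtain v where v: "v \<in> C" "c \<bullet> v = 1" "y = span {v}" by (rule domain_repE[OF y(1)])
    have "d x y < R + 1" using y by simp
    then obtain t s where ts: "0 < t" "0 < s" "u - t *\<^sub>R v \<in> C" "v - s *\<^sub>R u \<in> C" "\<eta> < t * s"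
      using u v by (auto simp: hilbert_dist_less_iff cone_close_def \<eta>_def)
    \<comment> \<open>Both vectors have height 1, so u - t v has height 1 - t > 0; then \<eta> < t s
      forces \<eta> < s.\<close>
    have "t < 1" using cone_pos[OF ts(3)] u v by (simp add: inner_diff_right)
    then have "\<eta> < s" using ts by (smt (verit) mult_less_cancel_right2)
    then have "(v - s *\<^sub>R u) + (s - \<eta>) *\<^sub>R u \<in> C" using ts u by (intro cone_add cone_scale) auto
    then have "(1 / (1 - \<eta>)) *\<^sub>R (v - \<eta> *\<^sub>R u) \<in> C"
      using \<eta> by (intro cone_scale) (auto simp: algebra_simps)
    then have "(1 / (1 - \<eta>)) *\<^sub>R (v - \<eta> *\<^sub>R u) \<in> W"
      using u v \<eta> closure_subset by (auto simp: W_def inner_diff_right)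
    moreover have "v = \<eta> *\<^sub>R u + (1 - \<eta>) *\<^sub>R ((1 / (1 - \<eta>)) *\<^sub>R (v - \<eta> *\<^sub>R u))" using \<eta> by simp
    ultimately show "y \<in> (\<lambda>v. span {v}) ` V" unfolding v(3) V_def by blast
  qed
qed

end


section \<open>The action of the projective group\<close>

lemma mat_mult_vec: "mat r *v v = r *\<^sub>R (v :: real^'n)"
proof -
  have "mat r = r *\<^sub>R (mat 1 :: real^'n^'n)" by (simp add: mat_def vec_eq_iff)
  then show ?thesis by (simp add: scaleR_matrix_vector_assoc[symmetric])
qed

lemma mat_mult_commute: "mat r ** A = A ** (mat r :: real^'n^'n)"
  by (simp add: matrix_eq matrix_vector_mul_assoc[symmetric] mat_mult_vec matrix_vector_mult_scaleR)

lemma normal_SL_scalars: "SL_scalars \<lhd> (SL :: (real^'n^'n) monoid)"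
proof -
  interpret SL: group "SL :: (real^'n^'n) monoid" by (rule group_SL)
  have comm: "h \<otimes>\<^bsub>SL\<^esub> x = x \<otimes>\<^bsub>SL\<^esub> h" if "h \<in> SL_scalars" for h x :: "real^'n^'n"
    using that by (auto simp: SL_scalars_def SL_def mat_mult_commute)
  have "subgroup SL_scalars (SL :: (real^'n^'n) monoid)"
  proof (rule SL.subgroupI)
    show "SL_scalars \<subseteq> carrier (SL :: (real^'n^'n) monoid)" by (auto simp: SL_scalars_def)
    have "mat 1 \<in> (SL_scalars :: (real^'n^'n) set)" by (auto simp: SL_scalars_def SL_def)
    then show "SL_scalars \<noteq> ({} :: (real^'n^'n) set)" by blast
  next
    fix a b :: "real^'n^'n" assume ab: "a \<in> SL_scalars" "b \<in> SL_scalars"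
    then obtain r s where rs: "a = mat r" "b = mat s" by (auto simp: SL_scalars_def)
    have "a ** b = mat (r * s)"
      by (simp add: rs matrix_eq matrix_vector_mul_assoc[symmetric] mat_mult_vec)
    moreover have "det (a ** b) = 1"
      using ab by (auto simp: SL_scalars_def SL_def det_mul)
    ultimately show "a \<otimes>\<^bsub>SL\<^esub> b \<in> SL_scalars"
      unfolding SL_scalars_def SL_def by simp blast
  next
    fix a :: "real^'n^'n" assume a: "a \<in> SL_scalars"
    then obtain r where r: "a = mat r" "a \<in> carrier SL" by (auto simp: SL_scalars_def)
    let ?b = "inv\<^bsub>SL\<^esub> a"
    have b: "?b \<in> carrier SL" "mat r ** ?b = mat 1"
      using r SL.r_inv[of a] SL.inv_closed[of a] by (auto simp: SL_def)
    have eq: "r *\<^sub>R (?b *v v) = v" for v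
    proof -
      have "r *\<^sub>R (?b *v v) = (mat r ** ?b) *v v"
        by (simp add: matrix_vector_mul_assoc[symmetric] mat_mult_vec)
      then show ?thesis by (simp add: b)
    qed
    have "?b *v v = (1 / r) *\<^sub>R v" for v
    \<comment> \<open>For r = 0, \<open>eq\<close> makes every vector vanish, and both sides are
      0.\<close>
    proof (cases "r = 0")
      case True
      then show ?thesis using eq[of "?b *v v"] eq[of v] by (simp add: matrix_vector_mult_0_right)
    next
      case False
      then have "?b *v v = (1 / r) *\<^sub>R (r *\<^sub>R (?b *v v))" by simp
      then show ?thesis by (simp only: eq)
    qed
    then have "?b = mat (1 / r)" by (simp add: matrix_eq mat_mult_vec)
    then show "?b \<in> SL_scalars" using b by (auto simp: SL_scalars_def)
  qed
  moreover have "x \<otimes>\<^bsub>SL\<^esub> h \<otimes>\<^bsub>SL\<^esub> inv\<^bsub>SL\<^esub> x \<in> SL_scalars"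
    if "x \<in> carrier SL" "h \<in> SL_scalars" for x h :: "real^'n^'n"
  proof -
    have h: "h \<in> carrier SL" using that(2) by (simp add: SL_scalars_def)
    have "x \<otimes>\<^bsub>SL\<^esub> h \<otimes>\<^bsub>SL\<^esub> inv\<^bsub>SL\<^esub> x = h"
      using that h comm[of h x] by (metis SL.inv_solve_right SL.m_closed)
    then show ?thesis using that by simp
  qed
  ultimately show ?thesis by (rule SL.normal_invI)
qed

lemma proj_act_coset:
  assumes "det A = 1"
  shows "proj_act (SL_scalars #>\<^bsub>SL\<^esub> A) (span {v}) = span {A *v v}"
proof -
  have "mat 1 \<in> (SL_scalars :: (real^'n^'n) set)" by (auto simp: SL_scalars_def SL_def)
  then have "A \<in> SL_scalars #>\<^bsub>SL\<^esub> A"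
    by (auto simp: r_coset_def SL_def intro!: bexI[of _ "mat 1"])
  then have "span {A *v v} \<subseteq> proj_act (SL_scalars #>\<^bsub>SL\<^esub> A) (span {v})"
    by (force simp: proj_act_def span_singleton matrix_vector_mult_scaleR[symmetric])
  moreover have "proj_act (SL_scalars #>\<^bsub>SL\<^esub> A) (span {v}) \<subseteq> span {A *v v}"
    by (auto simp: proj_act_def r_coset_def SL_scalars_def SL_def span_singleton
        matrix_vector_mul_assoc[symmetric] mat_mult_vec matrix_vector_mult_scaleR)
  ultimately show ?thesis by blast
qed

lemma PSL_repE:
  assumes "g \<in> carrier PSL"
  obtains A where "det A = 1" "g = SL_scalars #>\<^bsub>SL\<^esub> A"
  using assms by (auto simp: PSL_def carrier_FactGroup SL_def)

lemma group_PSL: "group PSL"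
  unfolding PSL_def by (rule normal.factorgroup_is_group[OF normal_SL_scalars])

lemma proj_act_mult:
  assumes "g \<in> carrier PSL" "h \<in> carrier PSL" "l \<in> projective_space"
  shows "proj_act (g \<otimes>\<^bsub>PSL\<^esub> h) l = proj_act g (proj_act h l)"
proof -
  obtain A where A: "det A = 1" "g = SL_scalars #>\<^bsub>SL\<^esub> A" by (rule PSL_repE[OF assms(1)])
  obtain B where B: "det B = 1" "h = SL_scalars #>\<^bsub>SL\<^esub> B" by (rule PSL_repE[OF assms(2)])
  obtain v where v: "l = span {v}" using assms(3) by (auto elim: projective_spaceE)
  have "g \<otimes>\<^bsub>PSL\<^esub> h = SL_scalars #>\<^bsub>SL\<^esub> (A \<otimes>\<^bsub>SL\<^esub> B)"
    using normal.rcos_sum[OF normal_SL_scalars, of A B] A B by (simp add: PSL_def SL_def)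
  also have "A \<otimes>\<^bsub>SL\<^esub> B = A ** B" by (simp add: SL_def)
  finally show ?thesis
    using A B by (simp add: v proj_act_coset det_mul matrix_vector_mul_assoc)
qed

lemma proj_act_one:
  fixes l :: "(real^'n) set"
  assumes "l \<in> projective_space"
  shows "proj_act \<one>\<^bsub>PSL\<^esub> l = l"
proof -
  interpret SL: group "SL :: (real^'n^'n) monoid" by (rule group_SL)
  obtain v where v: "l = span {v}" using assms by (auto elim: projective_spaceE)
  have "\<one>\<^bsub>PSL\<^esub> = (SL_scalars :: (real^'n^'n) set)" by (simp add: PSL_def)
  also have "\<dots> = SL_scalars #>\<^bsub>SL\<^esub> \<one>\<^bsub>SL\<^esub>"
    by (rule SL.coset_mult_one[symmetric]) (auto simp: SL_scalars_def)
  also have "\<one>\<^bsub>SL\<^esub> = mat 1" by (simp add: SL_def)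
  finally show ?thesis by (simp add: v proj_act_coset)
qed

context properly_convex_domain
begin

text \<open>A representative maps C into the union of C and -C, and the sign is constant because C
  is convex and \<open>c\<close> does not vanish on the image of C; so A or -A preserves C. The
  result is only asked to induce the action of \<open>g\<close>, since -A has determinant -1 when
  the number of coordinates is odd.\<close>

lemma Aut_repE:
  assumes "g \<in> Aut \<Omega>"
  obtains A where "\<And>v. v \<in> C \<Longrightarrow> A *v v \<in> C" "\<And>v. proj_act g (span {v}) = span {A *v v}"
proof -
  have g: "g \<in> carrier PSL" "proj_act g ` \<Omega> = \<Omega>" using assms by (auto simp: Aut_def)
  obtain A where A: "det A = 1" "g = SL_scalars #>\<^bsub>SL\<^esub> A" by (rule PSL_repE[OF g(1)])
  have act: "proj_act g (span {v}) = span {A *v v}" for v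
    using A by (simp add: proj_act_coset)
  have pm: "A *v v \<in> C \<or> - (A *v v) \<in> C" if "v \<in> C" for v
    using cone_span[OF that] g(2) act[of v] span_in_domain_iff by blast
  have nz: "c \<bullet> (A *v v) \<noteq> 0" if "v \<in> C" for v
    using pm[OF that] cone_pos by force
  have same_sign: False if "u \<in> C" "v \<in> C" "c \<bullet> (A *v u) < 0" "0 < c \<bullet> (A *v v)" for u v
  proof -
    \<comment> \<open>Both weights are positive, and they are chosen so that the image of
      \<open>w\<close> has height 0.\<close>
    define w where "w = (c \<bullet> (A *v v)) *\<^sub>R u + (- (c \<bullet> (A *v u))) *\<^sub>R v"
    have "w \<in> C" unfolding w_def using that by (intro cone_add cone_scale) auto
    moreover have "c \<bullet> (A *v w) = 0"
      by (simp add: w_def matrix_vector_right_distrib matrix_vector_mult_scaleR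
          matrix_vector_mult_diff_distrib inner_diff_right inner_add_right)
    ultimately show False using nz by blast
  qed
  show thesis
  proof (cases "\<forall>v\<in>C. 0 < c \<bullet> (A *v v)")
    case True
    then have "A *v v \<in> C" if "v \<in> C" for v
      using pm[OF that] cone_pos[of "- (A *v v)"] that by force
    then show thesis using that[of A] act by blast
  next
    case False
    then obtain u where u: "u \<in> C" "c \<bullet> (A *v u) < 0" using nz by force
    have neg: "(- A) *v v = - (A *v v)" for v
      by (simp add: vec_eq_iff matrix_vector_mult_def sum_negf)
    have "(- A) *v v \<in> C" if "v \<in> C" for v
      using pm[OF that] cone_pos[of "A *v v"] same_sign[OF u(1) that u(2)] nz[OF that] by (auto simp: neg)
    moreover have "proj_act g (span {v}) = span {(- A) *v v}" for v
      using act[of v] span_scaleR[of "-1" "A *v v"] by (simp add: neg)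
    ultimately show thesis using that[of "- A"] by blast
  qed
qed

lemma Aut_act_closed: "g \<in> Aut \<Omega> \<Longrightarrow> x \<in> \<Omega> \<Longrightarrow> proj_act g x \<in> \<Omega>"
  by (auto simp: Aut_def)

lemma Aut_act_le:
  assumes "g \<in> Aut \<Omega>" "x \<in> \<Omega>" "y \<in> \<Omega>"
  shows "d (proj_act g x) (proj_act g y) \<le> d x y"
proof -
  obtain A where A: "\<And>v. v \<in> C \<Longrightarrow> A *v v \<in> C" "\<And>v. proj_act g (span {v}) = span {A *v v}"
    using Aut_repE[OF assms(1)] by metis
  obtain u where u: "u \<in> C" "x = span {u}" by (rule domain_repE[OF assms(2)])
  obtain v where v: "v \<in> C" "y = span {v}" by (rule domain_repE[OF assms(3)])
  show ?thesis using hilbert_dist_matrix_le[OF A(1) u(1) v(1)] by (simp add: A(2) u v)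
qed

end


section \<open>Divisible domains\<close>

locale divisible_domain = properly_convex_domain \<Omega> c
  for \<Omega> :: "(real^'n) set set" and c +
  fixes \<Gamma> :: "(real^'n^'n) set set"
  assumes divides: "divides \<Gamma> \<Omega>"
    and dimension: "2 \<le> CARD('n)"
begin

sublocale PSL: group "PSL :: (real^'n^'n) set monoid" by (rule group_PSL)

lemma subgroup_\<Gamma>: "subgroup \<Gamma> PSL"
  using divides by (simp add: divides_def discrete_subgroup_PSL_def)

lemma in_PSL: "g \<in> \<Gamma> \<Longrightarrow> g \<in> carrier PSL"
  using subgroup_\<Gamma> by (rule subgroup.mem_carrier)

lemma in_Aut: "g \<in> \<Gamma> \<Longrightarrow> g \<in> Aut \<Omega>"
  using divides by (auto simp: divides_def)

lemma act_closed: "g \<in> \<Gamma> \<Longrightarrow> x \<in> \<Omega> \<Longrightarrow> proj_act g x \<in> \<Omega>"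
  by (rule Aut_act_closed[OF in_Aut])

lemma act_mult:
  "g \<in> \<Gamma> \<Longrightarrow> h \<in> \<Gamma> \<Longrightarrow> x \<in> \<Omega> \<Longrightarrow> proj_act (g \<otimes>\<^bsub>PSL\<^esub> h) x = proj_act g (proj_act h x)"
  using domain_subset by (intro proj_act_mult in_PSL) auto

lemma inv_\<Gamma>: "g \<in> \<Gamma> \<Longrightarrow> inv\<^bsub>PSL\<^esub> g \<in> \<Gamma>"
  by (rule subgroup.m_inv_closed[OF subgroup_\<Gamma>])

lemma act_inv:
  assumes "g \<in> \<Gamma>" "x \<in> \<Omega>"
  shows "proj_act (inv\<^bsub>PSL\<^esub> g) (proj_act g x) = x"
  using act_mult[OF inv_\<Gamma>[OF assms(1)] assms] in_PSL[OF assms(1)] proj_act_one assms domain_subset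
  by auto

lemma act_isometry:
  assumes "g \<in> \<Gamma>" "x \<in> \<Omega>" "y \<in> \<Omega>"
  shows "d (proj_act g x) (proj_act g y) = d x y"
proof (rule antisym)
  show "d (proj_act g x) (proj_act g y) \<le> d x y"
    using assms in_Aut by (intro Aut_act_le) auto
  have "d (proj_act (inv\<^bsub>PSL\<^esub> g) (proj_act g x)) (proj_act (inv\<^bsub>PSL\<^esub> g) (proj_act g y))
      \<le> d (proj_act g x) (proj_act g y)"
    using assms in_Aut inv_\<Gamma> act_closed by (intro Aut_act_le) auto
  then show "d x y \<le> d (proj_act g x) (proj_act g y)" using assms by (simp add: act_inv)
qed

section \<open>Orbits: coboundedness, finiteness in balls, counting\<close>

lemma orbit_cobounded:
  assumes "x \<in> \<Omega>"
  obtains D where "0 < D" "\<And>z. z \<in> \<Omega> \<Longrightarrow> \<exists>g\<in>\<Gamma>. d (proj_act g x) z < D"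
proof -
  let ?q = "\<lambda>x. (\<lambda>\<gamma>. proj_act \<gamma> x) ` \<Gamma>"
  let ?X = "subtopology projective_topology \<Omega>"
  let ?Y = "quotient_topology ?X ?q"
  have top_X: "topspace ?X = \<Omega>"
    using domain_subset by (auto simp: topspace_projective_topology)
  have comp: "compact_space ?Y" using divides by (simp add: divides_def cocompact_on_def)
  \<comment> \<open>Neighbourhoods of the whole orbit: open, increasing in n and exhausting
    \<Omega>. Being \<Gamma>-invariant, they are saturated, so their images are open in the compact
    quotient and finitely many cover it.\<close>
  define V where "V n = {z \<in> \<Omega>. \<exists>g\<in>\<Gamma>. d (proj_act g x) z < real n}" for n
  have V_sat: "z' \<in> V n" if z: "z \<in> V n" "z' \<in> \<Omega>" "?q z = ?q z'" for z z' n
  proof -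
    obtain g where g: "g \<in> \<Gamma>" "d (proj_act g x) z < real n" and z\<Omega>: "z \<in> \<Omega>" using z(1) by (auto simp: V_def)
    have "\<one>\<^bsub>PSL\<^esub> \<in> \<Gamma>" by (rule subgroup.one_closed[OF subgroup_\<Gamma>])
    then have "z' \<in> ?q z'" using proj_act_one[of z'] z(2) domain_subset by force
    then have "z' \<in> ?q z" unfolding z(3) .
    then obtain h where h: "h \<in> \<Gamma>" "z' = proj_act h z" by blast
    have "d (proj_act (h \<otimes>\<^bsub>PSL\<^esub> g) x) z' = d (proj_act g x) z"
      using h g assms z\<Omega> by (simp add: act_mult act_isometry act_closed)
    moreover have "h \<otimes>\<^bsub>PSL\<^esub> g \<in> \<Gamma>" using h g by (intro subgroup.m_closed[OF subgroup_\<Gamma>])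
    ultimately have "\<exists>k\<in>\<Gamma>. d (proj_act k x) z' < real n" using g(2) by metis
    then show ?thesis using z(2) by (simp add: V_def)
  qed
  have openV: "openin ?X (V n)" for n
  proof -
    have "V n = (\<Union>g\<in>\<Gamma>. {z \<in> \<Omega>. d (proj_act g x) z < real n})" by (auto simp: V_def)
    also have "openin projective_topology \<dots>"
      using assms by (intro openin_Union ballI) (auto intro!: ball_openin act_closed)
    finally have "openin projective_topology (V n)" .
    then show ?thesis by (simp add: openin_open_subtopology[OF domain_openin] V_def)
  qed
  have open_qV: "openin ?Y (?q ` V n)" for n
  proof -
    have "{z \<in> topspace ?X. ?q z \<in> ?q ` V n} = V n"
      unfolding top_X
    proof (intro equalityI subsetI)
      fix z assume "z \<in> {z \<in> \<Omega>. ?q z \<in> ?q ` V n}"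
      then obtain w where "w \<in> V n" "z \<in> \<Omega>" "?q w = ?q z" by fastforce
      then show "z \<in> V n" by (rule V_sat)
    next
      fix z assume z: "z \<in> V n"
      then have "z \<in> \<Omega>" by (simp add: V_def)
      then show "z \<in> {z \<in> \<Omega>. ?q z \<in> ?q ` V n}" using z by blast
    qed
    then show ?thesis
      using openV[of n] openin_subset[OF openV[of n]] by (auto simp: openin_quotient_topology)
  qed
  have "topspace ?Y \<subseteq> \<Union> (range (\<lambda>n. ?q ` V n))"
  proof
    fix o' assume "o' \<in> topspace ?Y"
    then obtain z where z: "z \<in> \<Omega>" "o' = ?q z" unfolding topspace_quotient_topology top_X by blast
    obtain n where "d (proj_act \<one>\<^bsub>PSL\<^esub> x) z < real n" using reals_Archimedean2 by blast
    then have "z \<in> V n" using z subgroup.one_closed[OF subgroup_\<Gamma>] by (auto simp: V_def)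
    then show "o' \<in> \<Union> (range (\<lambda>n. ?q ` V n))" using z by blast
  qed
  then obtain \<F> where F: "finite \<F>" "\<F> \<subseteq> range (\<lambda>n. ?q ` V n)" "topspace ?Y \<subseteq> \<Union> \<F>"
    using comp open_qV unfolding compact_space_alt by (metis (no_types, lifting) imageE)
  then obtain I where I: "finite I" "\<F> = (\<lambda>n. ?q ` V n) ` I" by (meson finite_subset_image)
  obtain N where N: "\<And>n. n \<in> I \<Longrightarrow> n \<le> N" using I(1) by (meson finite_nat_set_iff_bounded_le)
  show thesis
  \<comment> \<open>The \<open>+ 1\<close> keeps the constant positive when N = 0.\<close>
  proof (rule that[of "real N + 1"])
    fix z assume z: "z \<in> \<Omega>"
    then have "?q z \<in> topspace ?Y" unfolding topspace_quotient_topology top_X by blast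
    then obtain n where n: "n \<in> I" "?q z \<in> ?q ` V n" using F(3) I(2) by blast
    then have "z \<in> V n" using V_sat[of _ n z] z by auto
    then show "\<exists>g\<in>\<Gamma>. d (proj_act g x) z < real N + 1"
      using N[OF n(1)] by (force simp: V_def)
  qed simp
qed

text \<open>A compact K containing the ball around x also contains x, so every \<open>g\<close>
  counted here makes K meet its translate; proper discontinuity leaves finitely many.\<close>

lemma finite_orbit_ball:
  assumes "x \<in> \<Omega>"
  shows "finite {g \<in> \<Gamma>. d x (proj_act g x) \<le> R}"
proof -
  obtain K where K: "K \<subseteq> \<Omega>" "compactin projective_topology K"
    "\<And>y. y \<in> \<Omega> \<Longrightarrow> d x y \<le> \<bar>R\<bar> \<Longrightarrow> y \<in> K"
    using ball_subset_compact[OF assms, of "\<bar>R\<bar>"] by auto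
  have xK: "x \<in> K" using K(3)[OF assms] by simp
  have "{g \<in> \<Gamma>. d x (proj_act g x) \<le> R} \<subseteq> {g \<in> \<Gamma>. proj_act g ` K \<inter> K \<noteq> {}}"
  proof
    fix g assume g: "g \<in> {g \<in> \<Gamma>. d x (proj_act g x) \<le> R}"
    then have "proj_act g x \<in> K" using K(3) act_closed assms by auto
    then show "g \<in> {g \<in> \<Gamma>. proj_act g ` K \<inter> K \<noteq> {}}" using g xK by blast
  qed
  moreover have "finite {g \<in> \<Gamma>. proj_act g ` K \<inter> K \<noteq> {}}"
    using divides K by (auto simp: divides_def properly_discontinuous_on_def)
  ultimately show ?thesis by (rule finite_subset)
qed

lemma infinite_\<Gamma>:
  assumes "x \<in> \<Omega>"
  shows "infinite \<Gamma>"
proof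
  assume fin: "finite \<Gamma>"
  obtain D where D: "0 < D" "\<And>z. z \<in> \<Omega> \<Longrightarrow> \<exists>g\<in>\<Gamma>. d (proj_act g x) z < D"
    using orbit_cobounded[OF assms] by metis
  \<comment> \<open>The sum dominates each single displacement, so no point at distance R from x
    lies within D of the orbit.\<close>
  define R where "R = (\<Sum>g\<in>\<Gamma>. d x (proj_act g x)) + D"
  have nn: "0 \<le> d x (proj_act g x)" if "g \<in> \<Gamma>" for g
    using that assms by (intro hilbert_dist_nonneg act_closed)
  then have "0 \<le> (\<Sum>g\<in>\<Gamma>. d x (proj_act g x))" by (rule sum_nonneg)
  then have "0 < R" using D(1) by (simp add: R_def)
  then obtain z where z: "z \<in> \<Omega>" "d x z = R" using exists_at_distance[OF dimension assms] by metis
  obtain g where g: "g \<in> \<Gamma>" "d (proj_act g x) z < D" using D(2)[OF z(1)] by blast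
  have "d x z \<le> d x (proj_act g x) + d (proj_act g x) z"
    using assms z g by (intro hilbert_dist_triangle act_closed)
  also have "d x (proj_act g x) \<le> (\<Sum>g\<in>\<Gamma>. d x (proj_act g x))"
    using g(1) fin nn by (intro member_le_sum) auto
  finally show False using z(2) g(2) by (simp add: R_def)
qed

lemma orbit_count_submultiplicative:
  assumes x: "x \<in> \<Omega>"
  obtains D where "0 \<le> D"
    "\<And>R S. 0 \<le> R \<Longrightarrow> 0 \<le> S \<Longrightarrow>
      card {g \<in> \<Gamma>. d x (proj_act g x) \<le> R + S}
        \<le> card {g \<in> \<Gamma>. d x (proj_act g x) \<le> R + D} * card {g \<in> \<Gamma>. d x (proj_act g x) \<le> S + D}"
proof -
  obtain D where D: "0 < D" "\<And>z. z \<in> \<Omega> \<Longrightarrow> \<exists>g\<in>\<Gamma>. d (proj_act g x) z < D"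
    using orbit_cobounded[OF x] by metis
  define B where "B R = {g \<in> \<Gamma>. d x (proj_act g x) \<le> R}" for R
  have "card (B (R + S)) \<le> card (B (R + D)) * card (B (S + D))" if RS: "0 \<le> R" "0 \<le> S" for R S
  proof -
    have "\<exists>h. h \<in> B (R + D) \<and> inv\<^bsub>PSL\<^esub> h \<otimes>\<^bsub>PSL\<^esub> g \<in> B (S + D)" if g: "g \<in> B (R + S)" for g
    proof -
      have g\<Gamma>: "g \<in> \<Gamma>" "d x (proj_act g x) \<le> R + S" using g by (auto simp: B_def)
      have gx: "proj_act g x \<in> \<Omega>" using g\<Gamma> x by (intro act_closed)
      \<comment> \<open>The point at distance R on the segment from x to gx, or gx itself if that is
        closer than R.\<close>
      obtain z where z: "z \<in> \<Omega>" "d x z \<le> R" "d z (proj_act g x) \<le> S"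
      proof (cases "R \<le> d x (proj_act g x)")
        case True
        then show thesis
          using geodesic_point[OF x gx RS(1)] that g\<Gamma>(2) by (metis add.commute diff_le_eq order_refl)
      next
        case False
        then show thesis using that[OF gx] RS by simp
      qed
      obtain h where h: "h \<in> \<Gamma>" "d (proj_act h x) z < D" using D(2)[OF z(1)] by blast
      have hx: "proj_act h x \<in> \<Omega>" using h x by (intro act_closed)
      have "d x (proj_act h x) \<le> R + D"
        using hilbert_dist_triangle[OF x z(1) hx] hilbert_dist_sym[OF z(1) hx] z h by linarith
      moreover have "d x (proj_act (inv\<^bsub>PSL\<^esub> h \<otimes>\<^bsub>PSL\<^esub> g) x) \<le> S + D"
      proof -
        have "d x (proj_act (inv\<^bsub>PSL\<^esub> h \<otimes>\<^bsub>PSL\<^esub> g) x)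
            = d (proj_act (inv\<^bsub>PSL\<^esub> h) (proj_act h x)) (proj_act (inv\<^bsub>PSL\<^esub> h) (proj_act g x))"
          using h g\<Gamma> x by (simp add: act_mult inv_\<Gamma> act_inv)
        also have "\<dots> = d (proj_act h x) (proj_act g x)"
          using h hx gx by (intro act_isometry inv_\<Gamma>)
        also have "\<dots> \<le> d (proj_act h x) z + d z (proj_act g x)"
          by (rule hilbert_dist_triangle[OF hx z(1) gx])
        finally show ?thesis using h z by linarith
      qed
      ultimately show ?thesis
        using h g\<Gamma> inv_\<Gamma> subgroup.m_closed[OF subgroup_\<Gamma>] by (auto simp: B_def)
    qed
    then obtain h where h: "\<And>g. g \<in> B (R + S) \<Longrightarrow> h g \<in> B (R + D)"
      "\<And>g. g \<in> B (R + S) \<Longrightarrow> inv\<^bsub>PSL\<^esub> (h g) \<otimes>\<^bsub>PSL\<^esub> g \<in> B (S + D)"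
      by metis
    have fin: "finite (B R)" for R unfolding B_def by (rule finite_orbit_ball[OF x])
    \<comment> \<open>The product of the two entries recovers \<open>g\<close>, so the product of
      the two counts bounds the count of radius R + S.\<close>
    have "inj_on (\<lambda>g. (h g, inv\<^bsub>PSL\<^esub> (h g) \<otimes>\<^bsub>PSL\<^esub> g)) (B (R + S))"
    proof (rule inj_onI)
      fix g g' assume g: "g \<in> B (R + S)" "g' \<in> B (R + S)"
        "(h g, inv\<^bsub>PSL\<^esub> (h g) \<otimes>\<^bsub>PSL\<^esub> g) = (h g', inv\<^bsub>PSL\<^esub> (h g') \<otimes>\<^bsub>PSL\<^esub> g')"
      have "g \<in> carrier PSL" "g' \<in> carrier PSL" "inv\<^bsub>PSL\<^esub> (h g) \<in> carrier PSL"
        using g h(1)[OF g(1)] in_PSL inv_\<Gamma> by (auto simp: B_def)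
      then show "g = g'" using g(3) by (metis PSL.Units_l_cancel PSL.Units_eq prod.inject)
    qed
    then have "card (B (R + S)) \<le> card (B (R + D) \<times> B (S + D))"
      by (rule card_inj_on_le) (use h fin in auto)
    then show ?thesis by (simp add: card_cartesian_product)
  qed
  then show thesis using that[of D] D(1) by (simp add: B_def)
qed

text \<open>Changing both base points shifts every distance by at most \<open>d z x + d w y\<close>,
  hence every term by a bounded factor.\<close>

lemma poincare_converges_indep:
  assumes "x \<in> \<Omega>" "y \<in> \<Omega>" "z \<in> \<Omega>" "w \<in> \<Omega>" "0 \<le> s"
    and conv: "poincare_converges c \<Omega> \<Gamma> z w s"
  shows "poincare_converges c \<Omega> \<Gamma> x y s"
  unfolding poincare_converges_def
proof (rule summable_on_comparison_test)
  let ?K = "d z x + d w y"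
  show "(\<lambda>g. exp (s * ?K) * exp (- s * d z (proj_act g w))) summable_on \<Gamma>"
    using conv unfolding poincare_converges_def by (rule summable_on_cmult_right)
  fix g assume g: "g \<in> \<Gamma>"
  note in_\<Omega> = act_closed[OF g assms(2)] act_closed[OF g assms(4)]
  have "d z (proj_act g w) \<le> d z x + d x (proj_act g w)"
    by (rule hilbert_dist_triangle[OF assms(3,1) in_\<Omega>(2)])
  also have "d x (proj_act g w) \<le> d x (proj_act g y) + d (proj_act g y) (proj_act g w)"
    by (rule hilbert_dist_triangle[OF assms(1) in_\<Omega>])
  also have "d (proj_act g y) (proj_act g w) = d w y"
    using g assms by (simp add: act_isometry hilbert_dist_sym)
  finally have "d z (proj_act g w) \<le> ?K + d x (proj_act g y)" by simp
  then have "s * d z (proj_act g w) \<le> s * (?K + d x (proj_act g y))"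
    using assms(5) by (rule mult_left_mono)
  then show "exp (- s * d x (proj_act g y)) \<le> exp (s * ?K) * exp (- s * d z (proj_act g w))"
    by (simp add: exp_add[symmetric] algebra_simps)
qed simp

theorem divergent_type:
  assumes "x \<in> \<Omega>" "y \<in> \<Omega>"
  shows "\<not> poincare_converges c \<Omega> \<Gamma> x y (critical_exponent c \<Omega> \<Gamma>)"
proof -
  obtain D where D: "0 \<le> D"
    "\<And>R S. 0 \<le> R \<Longrightarrow> 0 \<le> S \<Longrightarrow>
      card {g \<in> \<Gamma>. d x (proj_act g x) \<le> R + S}
        \<le> card {g \<in> \<Gamma>. d x (proj_act g x) \<le> R + D} * card {g \<in> \<Gamma>. d x (proj_act g x) \<le> S + D}"
    by (rule orbit_count_submultiplicative[OF assms(1)]) (rule that; assumption)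
  obtain \<delta> where \<delta>: "0 \<le> \<delta>"
    "\<And>s. 0 \<le> s \<Longrightarrow> ((\<lambda>g. exp (- s * d x (proj_act g x))) summable_on \<Gamma>) = (\<delta> < s)"
  proof (rule critical_exponent_of_submultiplicative[where f = "\<lambda>g. d x (proj_act g x)" and G = \<Gamma>])
    show "0 \<le> d x (proj_act g x)" if "g \<in> \<Gamma>" for g
      using that assms by (intro hilbert_dist_nonneg act_closed)
    show "finite {g \<in> \<Gamma>. d x (proj_act g x) \<le> R}" for R by (rule finite_orbit_ball[OF assms(1)])
    show "infinite \<Gamma>" by (rule infinite_\<Gamma>[OF assms(1)])
    show "0 \<le> D" by (rule D(1))
    show "real (card {g \<in> \<Gamma>. d x (proj_act g x) \<le> R + S})
        \<le> real (card {g \<in> \<Gamma>. d x (proj_act g x) \<le> R + D}) * real (card {g \<in> \<Gamma>. d x (proj_act g x) \<le> S + D})"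
      if "0 \<le> R" "0 \<le> S" for R S
      unfolding of_nat_mult[symmetric] of_nat_le_iff by (rule D(2)[OF that])
  qed (rule that; assumption)
  have conv: "poincare_converges c \<Omega> \<Gamma> z w s \<longleftrightarrow> \<delta> < s" if "z \<in> \<Omega>" "w \<in> \<Omega>" "0 \<le> s" for z w s
  proof -
    have "poincare_converges c \<Omega> \<Gamma> z w s \<longleftrightarrow> poincare_converges c \<Omega> \<Gamma> x x s"
      using poincare_converges_indep assms that by blast
    then show ?thesis using \<delta>(2)[OF that(3)] by (simp add: poincare_converges_def)
  qed
  have "critical_exponent c \<Omega> \<Gamma> = \<delta>"
    unfolding critical_exponent_def
  proof (rule the_equality)
    show "0 \<le> \<delta> \<and> (\<forall>x\<in>\<Omega>. \<forall>y\<in>\<Omega>. \<forall>s\<ge>0. (\<delta> < s \<longrightarrow> poincare_converges c \<Omega> \<Gamma> x y s) \<and>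
        (s < \<delta> \<longrightarrow> \<not> poincare_converges c \<Omega> \<Gamma> x y s))"
      using \<delta>(1) conv by auto
  next
    fix \<epsilon> assume \<epsilon>: "0 \<le> \<epsilon> \<and> (\<forall>x\<in>\<Omega>. \<forall>y\<in>\<Omega>. \<forall>s\<ge>0. (\<epsilon> < s \<longrightarrow> poincare_converges c \<Omega> \<Gamma> x y s) \<and>
        (s < \<epsilon> \<longrightarrow> \<not> poincare_converges c \<Omega> \<Gamma> x y s))"
    have *: "\<epsilon> < s \<Longrightarrow> \<delta> < s" "s < \<epsilon> \<Longrightarrow> \<not> \<delta> < s" if "0 \<le> s" for s
      using \<epsilon> conv[OF assms that] assms that by blast+
    \<comment> \<open>At the midpoint of two distinct candidates, one would predict convergence and
      the other divergence.\<close>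
    show "\<epsilon> = \<delta>"
      using *[of "(\<epsilon> + \<delta>) / 2"] \<epsilon> \<delta>(1) by (cases \<epsilon> \<delta> rule: linorder_cases) auto
  qed
  then show ?thesis using conv[OF assms \<delta>(1)] by simp
qed

end

theorem corollary5p6:
  fixes \<Omega> :: "(real^4) set set" and c :: "real^4" and \<Gamma> :: "(real^4^4) set set"
  assumes "projective_domain \<Omega>"
    and "properly_convex_in c \<Omega>"
    and "indecomposable_in c \<Omega>"
    and "divides \<Gamma> \<Omega>"
    and "x \<in> \<Omega>" and "y \<in> \<Omega>"
  shows "\<not> (\<lambda>\<gamma>. exp (- critical_exponent c \<Omega> \<Gamma> * hilbert_dist c \<Omega> x (proj_act \<gamma> y)))
             summable_on \<Gamma>"
proof -
  interpret divisible_domain \<Omega> c \<Gamma>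
    using assms by unfold_locales auto
  show ?thesis
    using divergent_type[OF assms(5,6)] by (simp add: poincare_converges_def)
qed

end
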